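(* Let $L$ be an odd unimodular lattice in $\mathbb{R}^{12}$ with minimum norm $2$ (such a lattice exists and is unique up to isomorphism; it is usually denoted $D_{12}^+$). Then for a positive integer $k$, $L$ contains a $k$-frame if and only if $k \ge 2$.
   Context: A lattice $L\subset\mathbb{R}^n$ is unimodular if $L=L^*$, where $L^*=\{x\in\mathbb{R}^n : (x,y)\in\mathbb{Z} \text{ for all } y\in L\}$ and $(\cdot,\cdot)$ is the standard inner product. The norm of $x$ is $(x,x)$; the minimum norm of $L$ is the smallest norm of a nonzero vector of $L$. $L$ is odd if it contains a vector of odd norm. A $k$-frame of a lattice $L$ of dimension $n$ is a set of $n$ vectors $f_1,\dots,f_n\in L$ with $(f_i,f_j)=k\delta_{i,j}$. *)

theory Defs
  imports "HOL-Analysis.Analysis"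
begin

text \<open>A lattice is the set of integer combinations of a basis of the ambient space, so it
  always has full rank.\<close>

definition is_lattice :: "(real ^ 'n) set \<Rightarrow> bool" where
  "is_lattice L \<longleftrightarrow>
    (\<exists>B. independent B \<and> span B = UNIV \<and>
         L = {\<Sum>b\<in>B. of_int (c b) *\<^sub>R b | c :: real ^ 'n \<Rightarrow> int. True})"

definition dual_lattice :: "(real ^ 'n) set \<Rightarrow> (real ^ 'n) set" where
  "dual_lattice L = {x. \<forall>y\<in>L. x \<bullet> y \<in> \<int>}"

definition unimodular_lattice :: "(real ^ 'n) set \<Rightarrow> bool" where
  "unimodular_lattice L \<longleftrightarrow> is_lattice L \<and> L = dual_lattice L"

text \<open>Following lattice-theoretic usage, the norm of a vector \<open>x\<close> means \<open>x \<bullet> x\<close>, the square of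
  the library's \<open>norm x\<close>.\<close>

definition has_minimum_norm :: "(real ^ 'n) set \<Rightarrow> real \<Rightarrow> bool" where
  "has_minimum_norm L m \<longleftrightarrow>
    (\<exists>x\<in>L. x \<noteq> 0 \<and> x \<bullet> x = m) \<and> (\<forall>x\<in>L. x \<noteq> 0 \<longrightarrow> m \<le> x \<bullet> x)"

definition odd_lattice :: "(real ^ 'n) set \<Rightarrow> bool" where
  "odd_lattice L \<longleftrightarrow> (\<exists>x\<in>L. \<exists>m::int. odd m \<and> x \<bullet> x = of_int m)"

text \<open>The frame vectors are indexed by the coordinate type, whose cardinality is the dimension.\<close>

definition is_frame :: "nat \<Rightarrow> (real ^ 'n) set \<Rightarrow> ('n \<Rightarrow> real ^ 'n) \<Rightarrow> bool" where
  "is_frame k L f \<longleftrightarrow>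
    (\<forall>i. f i \<in> L) \<and> (\<forall>i j. f i \<bullet> f j = (if i = j then of_nat k else 0))"

definition contains_frame :: "nat \<Rightarrow> (real ^ 'n) set \<Rightarrow> bool" where
  "contains_frame k L \<longleftrightarrow> (\<exists>f. is_frame k L f)"

end

theory Submission
  imports Defs
begin

text \<open>Blichfeldt's packing argument, applied to the vectors of even norm that are even against the
  roots already found, produces twelve pairwise orthogonal vectors of norm 2 in \<open>L\<close>. They turn \<open>L\<close>
  into a binary self-dual code of length 12 with minimum weight 4, and a character sum over this code
  shows that \<open>L\<close> is \<open>D\<^sub>1\<^sub>2\<^sup>+\<close> with respect to an orthonormal basis: every combination of that
  basis whose coordinates are halves \<open>y\<^sub>i/2\<close> of odd integers with \<open>4\<close> dividing \<open>\<Sum>y\<^sub>i\<close> lies in \<open>L\<close>.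
  Multiplication by integral quaternions turns a \<open>k\<close>-frame into a \<open>(mk)\<close>-frame whenever \<open>m\<close> is
  a sum of four squares, so it suffices to find \<open>p\<close>-frames for primes \<open>p\<close>. For odd \<open>p\<close> an orthogonal
  design of order 12 does this as soon as \<open>4p = a\<^sup>2 + b\<^sup>2 + c\<^sup>2 + 9d\<^sup>2\<close> with odd \<open>a, b, c, d\<close>. Starting
  from \<open>p\<close> as a sum of four squares, such a representation is immediate unless \<open>p \<equiv> 1 (mod 3)\<close> and
  three of the squares are divisible by 9; then the imaginary part of the quaternion is reflected in
  vectors of norm 3, each step removing one factor 3, until it is no longer divisible by 3.\<close>

section \<open>Odd values of the form \<open>a\<^sup>2 + b\<^sup>2 + c\<^sup>2 + 9d\<^sup>2\<close>\<close>

text \<open>Integral matrices applied to a 2-frame give only even norms, while a vector of odd norm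
  in \<open>L\<close> has half-odd coordinates throughout the basis \<open>u\<close>. A frame of odd
  prime norm \<open>p\<close> therefore needs a design of order 12 without zeros: the weights 1, 1,
  1, 9 add up to 12, the rows have norm \<open>4 * p\<close>, and their halves have norm
  \<open>p\<close>. The weight 9 asks for a multiple of 3 among four odd numbers whose squares add
  up to \<open>4 * p\<close>, which is why all cases are sorted modulo 3. For the roots, coordinates
  along the \<open>j\<close> roots already found are confined to a half-open box of side sqrt 2. Two
  such lattice points whose difference is even against these roots differ by a vector orthogonal to
  them, so the packing takes place in the other \<open>12 - j\<close> coordinates. If
  \<open>N\<close> is the number of parity classes and no further root exists, then
  \<open>64 * unit_ball_vol (14 - j) <= N * pi\<close>. The obvious bound
  \<open>N <= 2 * 2 ^ j\<close> refutes this only for \<open>j <= 5\<close>; from six roots on the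
  bound \<open>N <= 64\<close> given by isotropy is indispensable.\<close>

lemma four_odd_squares_identity:
  fixes a b c d :: int
  shows "(a + b + c + d)^2 + (a + b - c - d)^2 + (a - b + c - d)^2 + (a - b - c + d)^2 = 4 * (a^2 + b^2 + c^2 + d^2)"
  by algebra

definition odd_rep :: "int \<Rightarrow> bool" where
  "odd_rep k \<longleftrightarrow> (\<exists>a b c d. odd a \<and> odd b \<and> odd c \<and> odd d \<and> 4 * k = a^2 + b^2 + c^2 + 9 * d^2)"

lemma odd_repI:
  assumes "odd a" "odd b" "odd c" "odd d" "4 * k = a^2 + b^2 + c^2 + d^2" "3 dvd d"
  shows "odd_rep k"
proof -
  obtain e where e: "d = 3 * e" using assms(6) by blast
  then have "d^2 = 9 * e^2" by (simp add: power2_eq_square)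
  with assms e show ?thesis unfolding odd_rep_def by auto
qed

lemma mod_3_cases: "(x::int) mod 3 = 0 \<or> x mod 3 = 1 \<or> x mod 3 = 2"
  by presburger

lemma square_mod_3: "(x::int)^2 mod 3 = (if 3 dvd x then 0 else 1)"
proof -
  have eq: "x^2 mod 3 = (x mod 3)^2 mod 3" by (simp add: power_mod)
  consider "x mod 3 = 0" | "x mod 3 = 1" | "x mod 3 = 2" using mod_3_cases[of x] by blast
  then show ?thesis unfolding eq by cases (auto simp: mod_0_imp_dvd)
qed

lemma sum4_mod:
  fixes a b c d m :: int
  shows "(a mod m + b mod m + c mod m + d mod m) mod m = (a + b + c + d) mod m"
  by (intro mod_add_cong) simp_all

text \<open>Sign changes make all four numbers 1 modulo 3, and then \<open>a - b - c + d\<close> is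
  a multiple of 3. The four terms of the identity share the parity of \<open>k\<close>, so they are
  odd.\<close>

lemma odd_rep_no_multiple_of_3:
  fixes a b c d k :: int
  assumes k: "k = a^2 + b^2 + c^2 + d^2" "odd k"
    and nz: "\<not> 3 dvd a" "\<not> 3 dvd b" "\<not> 3 dvd c" "\<not> 3 dvd d"
  shows "odd_rep k"
proof -
  have norm: "\<exists>y::int. y^2 = x^2 \<and> y mod 3 = 1" if "\<not> 3 dvd x" for x :: int
  proof (cases "x mod 3 = 1")
    case False
    with that have "(- x) mod 3 = 1" by presburger
    then show ?thesis by (intro exI[of _ "- x"]) auto
  qed auto
  obtain a' b' c' d' where s: "a'^2 = a^2" "b'^2 = b^2" "c'^2 = c^2" "d'^2 = d^2"
    and m: "a' mod 3 = 1" "b' mod 3 = 1" "c' mod 3 = 1" "d' mod 3 = 1"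
    using norm[OF nz(1)] norm[OF nz(2)] norm[OF nz(3)] norm[OF nz(4)] by metis
  have "odd (a'^2 + b'^2 + c'^2 + d'^2)" using k s by simp
  then have o: "odd (a' + b' + c' + d')" by simp
  show ?thesis
  proof (rule odd_repI)
    show "4 * k = (a' + b' + c' + d')^2 + (a' + b' - c' - d')^2 + (a' - b' + c' - d')^2 + (a' - b' - c' + d')^2"
      unfolding four_odd_squares_identity using k s by simp
    show "3 dvd a' - b' - c' + d'" using m by presburger
  qed (use o in auto)
qed

text \<open>\<open>k\<close> is the norm of the quaternion with real part \<open>s\<close> and
  imaginary part \<open>3 ^ j\<close> times \<open>(u, v, w)\<close>. Each step of the induction
  moves a factor 9 from the power into the vector.\<close>

lemma odd_rep_3_adic:
  fixes s u v w k :: int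
  assumes "k = s^2 + 9^j * (u^2 + v^2 + w^2)" "odd k" "k mod 3 = 1" "\<not> 3 dvd s"
    "\<not> (3 dvd u \<and> 3 dvd v \<and> 3 dvd w)"
  shows "odd_rep k"
  using assms
proof (induction j arbitrary: u v w)
  case 0
  \<comment> \<open>A square is 1 modulo 3 unless its base is a multiple of 3. As \<open>k\<close>
    and \<open>s^2\<close> are both 1, the number of nonmultiples among \<open>u\<close>,
    \<open>v\<close>, \<open>w\<close> is 0 or 3, and 0 is excluded.\<close>
  have "(s^2 mod 3 + u^2 mod 3 + v^2 mod 3 + w^2 mod 3) mod 3 = k mod 3"
    using 0 unfolding sum4_mod by (simp add: add.assoc)
  then have "\<not> 3 dvd u \<and> \<not> 3 dvd v \<and> \<not> 3 dvd w"
    using 0 by (auto simp: square_mod_3 split: if_splits)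
  then show ?case
    using 0 by (intro odd_rep_no_multiple_of_3[of k s u v w]) auto
next
  case (Suc j)
  \<comment> \<open>Three sign patterns suffice: if 3 divided all three sums, it would divide
    \<open>2 * w\<close> and \<open>2 * v\<close>, hence \<open>u\<close>, \<open>v\<close> and
    \<open>w\<close>.\<close>
  obtain e f g :: int where efg: "e^2 = 1" "f^2 = 1" "g^2 = 1" and t: "\<not> 3 dvd (e * u + f * v + g * w)"
  proof (cases "3 dvd (u + v + w) \<and> 3 dvd (u + v - w) \<and> 3 dvd (u - v + w)")
    case True
    have half: "3 dvd x" if "3 dvd 2 * x" for x :: int using that by presburger
    have "3 dvd 2 * w" "3 dvd 2 * v"
      using dvd_diff[of 3 "u + v + w" "u + v - w"] dvd_diff[of 3 "u + v + w" "u - v + w"] True by simp_all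
    then have vw: "3 dvd v" "3 dvd w" using half by blast+
    then have "3 dvd u"
      using dvd_diff[of 3 "u + v + w" "v + w"] dvd_add[OF vw] True by simp
    then show ?thesis using Suc.prems vw by simp
  next
    case False
    then show ?thesis
      using that[of 1 1 1] that[of 1 1 "-1"] that[of 1 "-1" 1] by fastforce
  qed
  \<comment> \<open>Reflecting the pure quaternion \<open>3(u,v,w)\<close> in a vector of norm 3 loses exactly one factor 3.\<close>
  define t where "t = e * u + f * v + g * w"
  define u' v' w' where "u' = 2 * t * e - 3 * u" and "v' = 2 * t * f - 3 * v" and "w' = 2 * t * g - 3 * w"
  have "u'^2 + v'^2 + w'^2 = 4 * t^2 * (e^2 + f^2 + g^2) - 12 * t * (e * u + f * v + g * w) + 9 * (u^2 + v^2 + w^2)"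
    unfolding u'_def v'_def w'_def by algebra
  then have "u'^2 + v'^2 + w'^2 = 9 * (u^2 + v^2 + w^2)"
    unfolding efg t_def[symmetric] by algebra
  then have k: "k = s^2 + 9^j * (u'^2 + v'^2 + w'^2)"
    using Suc.prems(1) by simp
  have "\<not> 3 dvd u'"
  proof
    assume "3 dvd u'"
    then have "3 dvd 2 * (t * e)" unfolding u'_def by (simp add: dvd_diff_left_iff mult.assoc)
    then have "3 dvd t * e" using prime_dvd_mult_iff[of 3 2 "t * e"] by simp
    then have "3 dvd t * e * e" by simp
    then show False using t efg(1) by (simp add: t_def power2_eq_square mult.assoc)
  qed
  then show ?case
    using Suc.IH[OF k] Suc.prems(2-4) by simp
qed

lemma extract_power_of_3:
  fixes x y z :: int
  assumes "x \<noteq> 0 \<or> y \<noteq> 0 \<or> z \<noteq> 0"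
  shows "\<exists>j u v w. x^2 + y^2 + z^2 = 9^j * (u^2 + v^2 + w^2) \<and> \<not> (3 dvd u \<and> 3 dvd v \<and> 3 dvd w)"
  using assms
proof (induction "nat (\<bar>x\<bar> + \<bar>y\<bar> + \<bar>z\<bar>)" arbitrary: x y z rule: less_induct)
  case less
  show ?case
  proof (cases "3 dvd x \<and> 3 dvd y \<and> 3 dvd z")
    case False
    then show ?thesis by (intro exI[of _ 0] exI[of _ x] exI[of _ y] exI[of _ z]) auto
  next
    case True
    then obtain x' y' z' where x': "x = 3 * x'" "y = 3 * y'" "z = 3 * z'" by (meson dvdE)
    have "nat (\<bar>x'\<bar> + \<bar>y'\<bar> + \<bar>z'\<bar>) < nat (\<bar>x\<bar> + \<bar>y\<bar> + \<bar>z\<bar>)" "x' \<noteq> 0 \<or> y' \<noteq> 0 \<or> z' \<noteq> 0"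
      using less.prems x' by auto
    from less.hyps[OF this] obtain j u v w where
      *: "x'^2 + y'^2 + z'^2 = 9^j * (u^2 + v^2 + w^2)" "\<not> (3 dvd u \<and> 3 dvd v \<and> 3 dvd w)"
      by blast
    have "x^2 + y^2 + z^2 = 9 * (x'^2 + y'^2 + z'^2)"
      by (simp add: x' power2_eq_square)
    then have "x^2 + y^2 + z^2 = 9^Suc j * (u^2 + v^2 + w^2)"
      using * by simp
    with * show ?thesis by blast
  qed
qed

text \<open>Squares are excluded because the imaginary part must be nonzero for a largest power of 9
  to be split off from its norm.\<close>

lemma odd_rep_one_nonmultiple_of_3:
  fixes s x y z k :: int
  assumes k: "k = s^2 + x^2 + y^2 + z^2" "odd k" "k mod 3 = 1" and sq: "\<And>m. k \<noteq> m^2"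
    and d: "\<not> 3 dvd s"
  shows "odd_rep k"
proof -
  have "x \<noteq> 0 \<or> y \<noteq> 0 \<or> z \<noteq> 0" using k sq[of s] by auto
  from extract_power_of_3[OF this] obtain j u v w where
    "x^2 + y^2 + z^2 = 9^j * (u^2 + v^2 + w^2)" "\<not> (3 dvd u \<and> 3 dvd v \<and> 3 dvd w)" by blast
  then show ?thesis
    using odd_rep_3_adic[of k s j u v w] k d by (simp add: add.assoc)
qed

text \<open>The number of summands prime to 3 is congruent to \<open>k\<close> modulo 3. In residue
  class 1 there is such a summand, which serves as real part. In class 2 the count is applied to the
  four odd numbers of the identity: since \<open>4 * k\<close> is again 2 modulo 3, exactly two of
  them are prime to 3, so another one is a multiple of 3.\<close>

lemma odd_rep_sum_of_four_squares:
  fixes a b c d k :: int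
  assumes k: "k = a^2 + b^2 + c^2 + d^2" "odd k" and sq: "\<And>m. k \<noteq> m^2" and k3: "k = 3 \<or> \<not> 3 dvd k"
  shows "odd_rep k"
proof -
  consider "k = 3" | "k mod 3 = 1" | "k mod 3 = 2" using k3 by (metis dvd_eq_mod_eq_0 mod_3_cases)
  then show ?thesis
  proof cases
    case 1
    \<comment> \<open>12 = 1 + 1 + 1 + 9.\<close>
    then show ?thesis unfolding odd_rep_def by (intro exI[of _ 1]) auto
  next
    case 2
    have "(a^2 mod 3 + b^2 mod 3 + c^2 mod 3 + d^2 mod 3) mod 3 = 1"
      using 2 k unfolding sum4_mod by simp
    then have "\<not> 3 dvd a \<or> \<not> 3 dvd b \<or> \<not> 3 dvd c \<or> \<not> 3 dvd d"
      by (auto simp: square_mod_3)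
    then consider "\<not> 3 dvd a" | "\<not> 3 dvd b" | "\<not> 3 dvd c" | "\<not> 3 dvd d" by blast
    then show ?thesis
    proof cases
      case 1
      show ?thesis by (rule odd_rep_one_nonmultiple_of_3[of k a b c d]) (use k 2 sq 1 in simp_all)
    next
      case 2
      show ?thesis by (rule odd_rep_one_nonmultiple_of_3[of k b a c d]) (use k \<open>k mod 3 = 1\<close> sq 2 in simp_all)
    next
      case 3
      show ?thesis by (rule odd_rep_one_nonmultiple_of_3[of k c a b d]) (use k 2 sq 3 in simp_all)
    next
      case 4
      show ?thesis by (rule odd_rep_one_nonmultiple_of_3[of k d a b c]) (use k 2 sq 4 in simp_all)
    qed
  next
    case 3
    define A B C D where "A = a + b + c + d" and "B = a + b - c - d" and "C = a - b + c - d" and "D = a - b - c + d"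
    have o: "odd A" "odd B" "odd C" "odd D"
      using k by (simp_all add: A_def B_def C_def D_def)
    have e: "4 * k = A^2 + B^2 + C^2 + D^2"
      unfolding A_def B_def C_def D_def four_odd_squares_identity using k by simp
    have "(4 * k) mod 3 = 2" using 3 by presburger
    then have "(A^2 mod 3 + B^2 mod 3 + C^2 mod 3 + D^2 mod 3) mod 3 = 2"
      using e unfolding sum4_mod by simp
    then have "3 dvd A \<or> 3 dvd B \<or> 3 dvd C \<or> 3 dvd D"
      by (auto simp: square_mod_3 split: if_splits)
    then consider "3 dvd A" | "3 dvd B" | "3 dvd C" | "3 dvd D" by blast
    then show ?thesis
    proof cases
      case 1
      have "4 * k = B^2 + C^2 + D^2 + A^2" using e by linarith
      then show ?thesis by (rule odd_repI[OF o(2) o(3) o(4) o(1) _ 1])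
    next
      case 2
      have "4 * k = A^2 + C^2 + D^2 + B^2" using e by linarith
      then show ?thesis by (rule odd_repI[OF o(1) o(3) o(4) o(2) _ 2])
    next
      case 3
      have "4 * k = A^2 + B^2 + D^2 + C^2" using e by linarith
      then show ?thesis by (rule odd_repI[OF o(1) o(2) o(4) o(3) _ 3])
    next
      case 4
      have "4 * k = A^2 + B^2 + C^2 + D^2" using e by linarith
      then show ?thesis by (rule odd_repI[OF o(1) o(2) o(3) o(4) _ 4])
    qed
  qed
qed

section \<open>Integration over a fundamental parallelepiped\<close>

text \<open>The integral over the space folds into the integral, over one fundamental parallelepiped
  \<open>P\<close>, of the sum of \<open>g\<close> over a translate of the lattice. Bounding finite
  partial sums is enough since \<open>g\<close> is nonnegative.\<close>

lemma lattice_nn_integral_le: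
  fixes \<phi> :: "real ^ 'n :: {finite, wellorder} \<Rightarrow> real ^ 'n :: {finite, wellorder}" and g :: "real ^ 'n :: {finite, wellorder} \<Rightarrow> ennreal"
  assumes lin: "linear \<phi>" and det: "det (matrix \<phi>) \<noteq> 0"
    and meas [measurable]: "g \<in> borel_measurable borel"
    and bound: "\<And>x F. finite F \<Longrightarrow> F \<subseteq> {z. \<forall>i. z $ i \<in> \<int>} \<Longrightarrow> (\<Sum>z\<in>F. g (x + \<phi> z)) \<le> c"
  shows "(\<integral>\<^sup>+x. g x \<partial>lborel) \<le> c * ennreal \<bar>det (matrix \<phi>)\<bar>"
proof -
  define Z where "Z = {z :: real ^ 'n :: {finite, wellorder}. \<forall>i. z $ i \<in> \<int>}"
  define U where "U = {t :: real ^ 'n :: {finite, wellorder}. \<forall>i. 0 \<le> t $ i \<and> t $ i < 1}"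
  define P where "P = \<phi> ` U"
  define h where "h = (\<lambda>n::nat. from_nat_into Z n)"
  have Zinf: "infinite Z"
  proof -
    have "inj (\<lambda>n::nat. (\<chi> i. of_nat n) :: real ^ 'n :: {finite, wellorder})"
      by (auto simp: inj_def vec_eq_iff)
    moreover have "range (\<lambda>n::nat. (\<chi> i. of_nat n) :: real ^ 'n :: {finite, wellorder}) \<subseteq> Z"
      by (auto simp: Z_def)
    ultimately show ?thesis
      using infinite_iff_countable_subset by blast
  qed
  have Zc: "countable Z"
  proof -
    have "Z \<subseteq> range (\<lambda>f :: 'n \<Rightarrow> int. \<chi> i. of_int (f i))"
    proof
      fix z assume "z \<in> Z"
      then have "z = (\<chi> i. of_int \<lfloor>z $ i\<rfloor>)"
        by (auto simp: Z_def vec_eq_iff elim!: Ints_cases)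
      then show "z \<in> range (\<lambda>f :: 'n \<Rightarrow> int. \<chi> i. of_int (f i))"
        by (metis rangeI)
    qed
    then show ?thesis
      by (meson countable_subset countableI_type countable_image)
  qed
  have bij: "bij_betw h UNIV Z"
    unfolding h_def by (rule bij_betw_from_nat_into[OF Zc Zinf])
  obtain B where B: "matrix \<phi> ** B = mat 1" "B ** matrix \<phi> = mat 1"
    using det invertible_det_nz invertible_def by blast
  define \<psi> where "\<psi> = (\<lambda>x. B *v x)"
  have \<phi>: "\<phi> x = matrix \<phi> *v x" for x
    using lin by (simp add: matrix_works)
  have inv1: "\<phi> (\<psi> x) = x" and inv2: "\<psi> (\<phi> x) = x" for x
    by (simp_all add: \<phi> \<psi>_def matrix_vector_mul_assoc B)
  have \<psi>add: "\<psi> (x - y) = \<psi> x - \<psi> y" for x y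
    by (simp add: \<psi>_def matrix_vector_mult_diff_distrib)
  have cont\<psi>: "continuous_on UNIV \<psi>"
    unfolding \<psi>_def by (intro linear_continuous_on matrix_vector_mul_bounded_linear)
  have U_eq: "U = (\<Inter>i. {t. 0 \<le> t $ i} \<inter> {t. t $ i < 1})"
    by (auto simp: U_def)
  have Ub [measurable]: "U \<in> sets borel"
    unfolding U_eq
    by (intro sets.countable_INT'' sets.Int borel_closed borel_open closed_Collect_le open_Collect_less
          continuous_intros) auto
  have P_eq: "P = \<psi> -` U"
    proof (rule set_eqI)
    fix x
    show "x \<in> P \<longleftrightarrow> x \<in> \<psi> -` U"
      unfolding P_def using inv1[of x] inv2 by (metis imageE imageI vimageE vimageI)
  qed
  have Pb [measurable]: "P \<in> sets borel"
    unfolding P_eq using measurable_sets[OF borel_measurable_continuous_onI[OF cont\<psi>] Ub] by simp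
  have U_sub: "U \<subseteq> cbox 0 (\<chi> i. 1)"
    by (auto simp: U_def mem_box_cart less_imp_le)
  have Ulm: "U \<in> lmeasurable"
    by (rule bounded_set_imp_lmeasurable[OF bounded_subset[OF bounded_cbox U_sub]]) simp
  have "measure lebesgue U \<le> measure lebesgue (cbox 0 (\<chi> i. 1) :: (real ^ 'n :: {finite, wellorder}) set)"
    by (rule measure_mono_fmeasurable[OF U_sub]) (use Ulm in auto)
  also have "\<dots> = 1"
    by (subst measure_completion) (auto simp: content_cbox_cart interval_eq_empty_cart)
  finally have U1: "measure lebesgue U \<le> 1" .
  have "measure lebesgue P = \<bar>det (matrix \<phi>)\<bar> * measure lebesgue U" "P \<in> lmeasurable"
    unfolding P_def using measure_linear_image[OF lin Ulm] measurable_linear_image[OF lin Ulm] by auto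
  then have "emeasure lebesgue P \<le> ennreal \<bar>det (matrix \<phi>)\<bar>"
    using U1 by (auto simp: emeasure_eq_measure2 intro!: ennreal_leI mult_left_le)
  then have Pm: "emeasure lborel P \<le> ennreal \<bar>det (matrix \<phi>)\<bar>"
    by simp
  \<comment> \<open>The translates of \<open>P\<close> tile the space: \<open>x\<close> lies in
    exactly one of them, found by rounding down its lattice coordinates.\<close>
  have part: "g x = (\<integral>\<^sup>+z. g x * indicator P (x - \<phi> z) \<partial>count_space Z)" for x
  proof -
    define z0 where "z0 = ((\<chi> i. of_int \<lfloor>\<psi> x $ i\<rfloor>) :: real ^ 'n :: {finite, wellorder})"
    have z0: "z0 \<in> Z" "x - \<phi> z0 \<in> P"
      unfolding P_eq by (auto simp: z0_def Z_def U_def \<psi>add inv2) linarith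
    have "x - \<phi> z \<notin> P" if "z \<in> Z" "z \<noteq> z0" for z
    proof
      assume "x - \<phi> z \<in> P"
      then have *: "0 \<le> \<psi> x $ i - z $ i" "\<psi> x $ i - z $ i < 1" for i
        by (auto simp: P_eq U_def \<psi>add inv2)
      have "z $ i = z0 $ i" for i
        using that(1) *[of i] by (auto simp: Z_def z0_def elim!: Ints_cases dest!: spec[of _ i]) linarith
      then show False
        using that by (simp add: vec_eq_iff)
    qed
    then have "(\<integral>\<^sup>+z. g x * indicator P (x - \<phi> z) \<partial>count_space Z)
      = (\<Sum>z\<in>{z0}. g x * indicator P (x - \<phi> z))"
      using z0 by (intro nn_integral_count_space') (auto simp: indicator_def)
    then show ?thesis
      using z0 by simp
  qed
  have shift: "(\<integral>\<^sup>+x. g x * indicator P (x - \<phi> z) \<partial>lborel) = (\<integral>\<^sup>+x. g (x + \<phi> z) * indicator P x \<partial>lborel)" for z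
  proof -
    have "(\<integral>\<^sup>+x. g x * indicator P (x - \<phi> z) \<partial>lborel)
      = (\<integral>\<^sup>+x. g x * indicator P (x - \<phi> z) \<partial>distr lborel borel ((+) (\<phi> z)))"
      by (simp add: lborel_distr_plus)
    also have "\<dots> = (\<integral>\<^sup>+x. g (x + \<phi> z) * indicator P x \<partial>lborel)"
      by (subst nn_integral_distr) (auto simp: add.commute)
    finally show ?thesis .
  qed
  have sums: "(\<integral>\<^sup>+z. g (x + \<phi> z) \<partial>count_space Z) \<le> c" for x
  proof -
    have "(\<integral>\<^sup>+z. g (x + \<phi> z) \<partial>count_space Z) = (\<integral>\<^sup>+n. g (x + \<phi> (h n)) \<partial>count_space UNIV)"
      by (rule nn_integral_bij_count_space[OF bij, symmetric])
    also have "\<dots> = (\<Sum>n. g (x + \<phi> (h n)))"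
      by (rule nn_integral_count_space_nat)
    also have "\<dots> \<le> c"
    proof (rule suminf_le_const)
      fix n
      have "(\<Sum>k<n. g (x + \<phi> (h k))) = (\<Sum>z\<in>h ` {..<n}. g (x + \<phi> z))"
        using bij by (subst sum.reindex) (auto simp: bij_betw_def inj_on_def)
      also have "\<dots> \<le> c"
        using bij by (intro bound) (auto simp: bij_betw_def Z_def)
      finally show "(\<Sum>k<n. g (x + \<phi> (h k))) \<le> c" .
    qed simp
    finally show ?thesis .
  qed
  have "(\<integral>\<^sup>+x. g x \<partial>lborel) = (\<integral>\<^sup>+x. (\<integral>\<^sup>+z. g x * indicator P (x - \<phi> z) \<partial>count_space Z) \<partial>lborel)"
    using part by simp
  also have "\<dots> = (\<integral>\<^sup>+z. (\<integral>\<^sup>+x. g x * indicator P (x - \<phi> z) \<partial>lborel) \<partial>count_space Z)"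
    by (rule nn_integral_count_space_nn_integral[OF Zc]) measurable
  also have "\<dots> = (\<integral>\<^sup>+z. (\<integral>\<^sup>+x. g (x + \<phi> z) * indicator P x \<partial>lborel) \<partial>count_space Z)"
    by (simp add: shift)
  also have "\<dots> = (\<integral>\<^sup>+x. (\<integral>\<^sup>+z. g (x + \<phi> z) * indicator P x \<partial>count_space Z) \<partial>lborel)"
    by (rule nn_integral_count_space_nn_integral[OF Zc, symmetric]) measurable
  also have "\<dots> = (\<integral>\<^sup>+x. (\<integral>\<^sup>+z. g (x + \<phi> z) \<partial>count_space Z) * indicator P x \<partial>lborel)"
    by (intro nn_integral_cong nn_integral_multc) auto
  also have "\<dots> \<le> (\<integral>\<^sup>+x. c * indicator P x \<partial>lborel)"
    by (intro nn_integral_mono mult_right_mono sums) auto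
  also have "\<dots> = c * emeasure lborel P"
    by (simp add: nn_integral_cmult_indicator)
  also have "\<dots> \<le> c * ennreal \<bar>det (matrix \<phi>)\<bar>"
    by (rule mult_left_mono[OF Pm]) simp
  finally show ?thesis .
qed

text \<open>Minkowski's theorem for balls. If every nonzero lattice vector had length at least
  \<open>2 * r\<close>, a translate of the lattice would meet the open ball of radius
  \<open>r\<close> at most once, so the ball would have at most the volume of a fundamental
  cell.\<close>

lemma short_lattice_vector:
  fixes \<phi> :: "real ^ 'n :: {finite, wellorder} \<Rightarrow> real ^ 'n :: {finite, wellorder}"
  assumes lin: "linear \<phi>" and det: "det (matrix \<phi>) \<noteq> 0" and r: "r \<ge> 0"
    and vol: "\<bar>det (matrix \<phi>)\<bar> < unit_ball_vol (CARD('n)) * r ^ CARD('n)"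
  shows "\<exists>z. z \<noteq> 0 \<and> (\<forall>i. z $ i \<in> \<int>) \<and> norm (\<phi> z) < 2 * r"
proof (rule ccontr)
  assume neg: "\<not> ?thesis"
  have "(\<integral>\<^sup>+x. indicator (ball (0 :: real ^ 'n :: {finite, wellorder}) r) x \<partial>lborel) \<le> 1 * ennreal \<bar>det (matrix \<phi>)\<bar>"
  proof (rule lattice_nn_integral_le[OF lin det])
    fix x :: "real ^ 'n :: {finite, wellorder}" and F :: "(real ^ 'n :: {finite, wellorder}) set"
    assume F: "finite F" "F \<subseteq> {z. \<forall>i. z $ i \<in> \<int>}"
    define G where "G = {z\<in>F. x + \<phi> z \<in> ball 0 r}"
    have "z = z'" if z: "z \<in> G" "z' \<in> G" for z z'
    proof (rule ccontr)
      assume "z \<noteq> z'"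
      then have "z - z' \<noteq> 0" by simp
      moreover have "\<forall>i. (z - z') $ i \<in> \<int>" using z F(2) Ints_diff by (simp add: G_def subset_iff)
      ultimately have "2 * r \<le> norm (\<phi> (z - z'))" using neg by (meson not_le)
      also have "\<phi> (z - z') = (x + \<phi> z) - (x + \<phi> z')"
        using lin by (simp add: linear_diff)
      also have "norm \<dots> \<le> norm (x + \<phi> z) + norm (x + \<phi> z')" by (rule norm_triangle_ineq4)
      also have "\<dots> < 2 * r" using z by (auto simp: G_def)
      finally show False by simp
    qed
    moreover have "finite G" using F by (simp add: G_def)
    ultimately have "card G \<le> 1" by (simp add: card_le_Suc0_iff_eq)
    have "(\<Sum>z\<in>F. indicator (ball 0 r) (x + \<phi> z) :: ennreal) = of_nat (card G)"
      using F(1) by (simp add: G_def indicator_def sum.If_cases Int_def)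
    also have "\<dots> \<le> 1" using \<open>card G \<le> 1\<close> by (cases "card G") auto
    finally show "(\<Sum>z\<in>F. indicator (ball 0 r) (x + \<phi> z) :: ennreal) \<le> 1" .
  qed (rule borel_measurable_indicator, simp)
  then show False
    using vol r by (simp add: emeasure_ball ennreal_leI ennreal_le_iff)
qed

section \<open>Sums of four squares\<close>

text \<open>Pigeonhole: with both variables in \<open>{0..(p - 1) div 2}\<close>, the values
  \<open>a^2\<close> and \<open>-1 - b^2\<close> each occupy \<open>(p + 1) div 2\<close> residues
  modulo \<open>p\<close>, too many to be disjoint.\<close>

lemma exists_sum_two_squares_plus_one:
  fixes p :: nat
  assumes p: "prime p" "odd p"
  shows "\<exists>a b :: int. int p dvd a^2 + b^2 + 1"
proof -
  define m where "m = (p - 1) div 2"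
  have pm: "p = 2 * m + 1" using p(2) by (auto simp: m_def elim!: oddE)
  define A where "A = (\<lambda>a::int. a^2 mod int p) ` {0..int m}"
  define B where "B = (\<lambda>b::int. (- 1 - b^2) mod int p) ` {0..int m}"
  have sq_inj: "a = b" if "a \<in> {0..int m}" "b \<in> {0..int m}" "int p dvd a^2 - b^2" for a b :: int
  proof -
    have "a^2 - b^2 = (a - b) * (a + b)" by (simp add: power2_eq_square algebra_simps)
    with that have "int p dvd a - b \<or> int p dvd a + b"
      using p(1) by (metis prime_dvd_mult_iff prime_nat_int_transfer)
    then show ?thesis
    proof
      assume *: "int p dvd a - b"
      have "\<bar>a - b\<bar> < int p" using that pm by auto
      with * have "a - b = 0" using zdvd_not_zless[of "\<bar>a - b\<bar>" "int p"] by fastforce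
      then show ?thesis by simp
    next
      assume *: "int p dvd a + b"
      have "a + b < int p" "0 \<le> a + b" using that pm by auto
      with * have "a + b = 0" using zdvd_not_zless[of "a + b" "int p"] by fastforce
      then show ?thesis using that by auto
    qed
  qed
  have cA: "card A = m + 1"
    unfolding A_def by (subst card_image) (auto simp: inj_on_def mod_eq_dvd_iff intro!: sq_inj)
  have cB: "card B = m + 1"
  proof -
    have "inj_on (\<lambda>b::int. (- 1 - b^2) mod int p) {0..int m}"
    proof (rule inj_onI)
      fix a b assume ab: "a \<in> {0..int m}" "b \<in> {0..int m}" and "(- 1 - a^2) mod int p = (- 1 - b^2) mod int p"
      then have "int p dvd (- 1 - a^2) - (- 1 - b^2)" by (simp only: mod_eq_dvd_iff)
      then have "int p dvd b^2 - a^2" by simp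
      then show "a = b" using sq_inj[OF ab(2,1)] by simp
    qed
    then show ?thesis unfolding B_def by (subst card_image) auto
  qed
  have "A \<union> B \<subseteq> {0..<int p}" using pm by (auto simp: A_def B_def)
  then have "card (A \<union> B) \<le> p" using card_mono[of "{0..<int p}" "A \<union> B"] by simp
  moreover have "card (A \<union> B) + card (A \<inter> B) = card A + card B"
    by (rule card_Un_Int[symmetric]) (auto simp: A_def B_def)
  ultimately have "card (A \<inter> B) \<noteq> 0" using cA cB pm by simp
  then obtain a b :: int where "a^2 mod int p = (- 1 - b^2) mod int p"
    by (metis (no_types, lifting) A_def B_def IntE card.empty ex_in_conv imageE)
  then have "int p dvd a^2 - (- 1 - b^2)" by (simp only: mod_eq_dvd_iff)
  then show ?thesis by (intro exI[of _ a] exI[of _ b]) (simp add: algebra_simps)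
qed

text \<open>On the vectors \<open>(s, t, x, y)\<close> with \<open>x = a s + b t\<close> and
  \<open>y = b s - a t\<close> modulo \<open>p\<close>, the norm is congruent to
  \<open>(a^2 + b^2 + 1) * (s^2 + t^2)\<close>, that is to 0. A nonzero vector of norm below
  \<open>2 * p\<close> then has norm \<open>p\<close>.\<close>

lemma prime_sum_of_four_squares:
  fixes p :: nat
  assumes p: "prime p"
  shows "\<exists>a b c d :: int. int p = a^2 + b^2 + c^2 + d^2"
proof (cases "odd p")
  case False
  then have "p = 2" using p primes_dvd_imp_eq two_is_prime_nat by blast
  then show ?thesis by (intro exI[of _ 1] exI[of _ 1] exI[of _ 0] exI[of _ 0]) simp
next
  case True
  from exists_sum_two_squares_plus_one[OF p True] obtain a b :: int where ab: "int p dvd a^2 + b^2 + 1" by blast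
  \<comment> \<open>In the index type \<open>4\<close> the numeral 4 is 0, so the indices are
    ordered 4, 1, 2, 3. The parameters \<open>s\<close>, \<open>t\<close> sit at 4 and 1 to make the
    matrix lower triangular.\<close>
  define \<phi> :: "real ^ 4 \<Rightarrow> real ^ 4" where
    "\<phi> t = (\<chi> i. if i = 2 then of_int a * t $ 4 + of_int b * t $ 1 + p * t $ 2
      else if i = 3 then of_int b * t $ 4 - of_int a * t $ 1 + p * t $ 3 else t $ i)" for t
  have lin: "linear \<phi>"
    by (rule linearI) (simp_all add: \<phi>_def vec_eq_iff algebra_simps)
  have det: "det (matrix \<phi>) = of_nat p ^ 2"
  proof -
    have "matrix \<phi> $ i $ j = 0" if "i < j" for i j :: 4
      using that exhaust_4[of i] exhaust_4[of j]
      by (auto simp: matrix_def \<phi>_def less_bit0_def bit0.Rep_numeral bit0.Rep_0 bit0.Rep_1 axis_def)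
    then have "det (matrix \<phi>) = (\<Prod>i\<in>UNIV. matrix \<phi> $ i $ i)"
      by (rule det_lowerdiagonal)
    also have "\<dots> = of_nat p ^ 2"
      unfolding UNIV_4 by (simp add: matrix_def \<phi>_def axis_def power2_eq_square)
    finally show ?thesis .
  qed
  have p0: "p > 0" using p prime_gt_0_nat by blast
  \<comment> \<open>With \<open>(2 * r)^2 = 2 * p\<close> the ball has volume
    \<open>pi^2 / 8 * p^2\<close>, which exceeds the determinant \<open>p^2\<close> because
    \<open>pi > 3\<close>.\<close>
  define r where "r = sqrt (p / 2)"
  have r2: "r^2 = p / 2" by (simp add: r_def)
  have "(8 :: real) < pi^2"
    using power_strict_mono[of 3 pi 2] pi_gt3 by simp
  moreover have r4: "r ^ 4 = (p * p) / 4"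
    using power_mult[of r 2 2] by (simp add: r2) (simp add: power2_eq_square)
  ultimately have vol: "\<bar>det (matrix \<phi>)\<bar> < unit_ball_vol (CARD(4)) * r ^ CARD(4)"
    using p0 r2 by (simp add: det unit_ball_vol_4 r4 power2_eq_square)
  obtain z where z: "z \<noteq> 0" "\<forall>i. z $ i \<in> \<int>" "norm (\<phi> z) < 2 * r"
    using short_lattice_vector[OF lin _ _ vol] p0 by (auto simp: det r_def)
  obtain s t u v :: int where st: "z $ 4 = s" "z $ 1 = t" "z $ 2 = u" "z $ 3 = v"
    using z(2) by (metis Ints_cases)
  define x y where "x = a * s + b * t + int p * u" and "y = b * s - a * t + int p * v"
  have "norm (\<phi> z) ^ 2 = of_int (s^2 + t^2 + x^2 + y^2)"
    unfolding power2_norm_eq_inner by (simp add: inner_vec_def sum_4 \<phi>_def st x_def y_def power2_eq_square)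
  moreover have "norm (\<phi> z) ^ 2 < (2 * r) ^ 2"
    using z(3) by (intro power_strict_mono) auto
  ultimately have "real_of_int (s^2 + t^2 + x^2 + y^2) < of_int (2 * int p)"
    by (simp add: r2 power_mult_distrib)
  then have lt: "s^2 + t^2 + x^2 + y^2 < 2 * int p" by linarith
  have pos: "s^2 + t^2 + x^2 + y^2 > 0"
  proof (rule ccontr)
    assume "\<not> s^2 + t^2 + x^2 + y^2 > 0"
    then have "s = 0 \<and> t = 0 \<and> x = 0 \<and> y = 0"
      by (smt (verit) zero_le_power2 zero_less_power2)
    then have "s = 0" "t = 0" "u = 0" "v = 0" using p0 by (auto simp: x_def y_def)
    then have "z = 0" using st by (simp add: vec_eq_iff forall_4)
    then show False using z(1) by simp
  qed
  have "s^2 + t^2 + x^2 + y^2 = (a^2 + b^2 + 1) * (s^2 + t^2)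
      + int p * (2 * u * (a * s + b * t) + int p * u^2 + 2 * v * (b * s - a * t) + int p * v^2)"
    unfolding x_def y_def by algebra
  then have "int p dvd s^2 + t^2 + x^2 + y^2" using ab by simp
  then obtain k where k: "s^2 + t^2 + x^2 + y^2 = int p * k" by blast
  have "0 < int p * k" using pos k by simp
  then have "0 < k" using p0 by (simp add: zero_less_mult_iff)
  moreover have "int p * k < int p * 2" using lt k by simp
  then have "k < 2" using p0 by (simp only: mult_less_cancel_left_pos of_nat_0_less_iff)
  ultimately have "k = 1" by simp
  with k have "int p = s^2 + t^2 + x^2 + y^2" by simp
  then show ?thesis by blast
qed

section \<open>Frames from orthogonal designs\<close>

text \<open>Applied to a frame with an integral matrix, and to an orthonormal basis with the
  circulant design. The enumeration \<open>e\<close> carries list positions over to the index type;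
  that each \<open>g i\<close> comes from some row is all that membership in the lattice
  requires.\<close>

lemma combination_of_frame:
  fixes f :: "12 \<Rightarrow> real ^ 12" and M :: "real list list"
  assumes f: "\<And>i j. f i \<bullet> f j = (if i = j then k else 0)"
    and M: "\<forall>m<12. \<forall>n<12. (\<Sum>t<12. M ! m ! t * M ! n ! t) = (if m = n then q else 0)"
    and e: "bij_betw e {..<12::nat} UNIV"
  shows "\<exists>g :: 12 \<Rightarrow> real ^ 12. (\<forall>i. \<exists>m<12. g i = (\<Sum>t<12. (M ! m ! t) *\<^sub>R f (e t)))
    \<and> (\<forall>i j. g i \<bullet> g j = (if i = j then q * k else 0))"
proof -
  define h where "h = inv_into {..<12} e"
  have h: "h i < 12" "e (h i) = i" for i
    using bij_betwE[OF bij_betw_inv_into[OF e]] bij_betw_inv_into_right[OF e] by (auto simp: h_def)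
  have inj: "e s = e t \<longleftrightarrow> s = t" if "s < 12" "t < 12" for s t
    using e that by (auto simp: bij_betw_def inj_on_def)
  define g where "g i = (\<Sum>t<12. (M ! h i ! t) *\<^sub>R f (e t))" for i
  have "g i \<bullet> g j = (if i = j then q * k else 0)" for i j
  proof -
    have "g i \<bullet> g j = (\<Sum>s<12. \<Sum>t<12. M ! h i ! s * (M ! h j ! t * (f (e s) \<bullet> f (e t))))"
      unfolding g_def by (subst inner_sum_left, intro sum.cong refl, subst inner_sum_right) (simp add: sum_distrib_left mult.left_commute)
    also have "\<dots> = (\<Sum>s<12. \<Sum>t<12. if s = t then M ! h i ! s * M ! h j ! s * k else 0)"
      by (intro sum.cong refl) (simp add: f inj)
    also have "\<dots> = (\<Sum>s<12. M ! h i ! s * M ! h j ! s) * k"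
      by (simp add: sum.delta' sum_distrib_right)
    also have "\<dots> = (if i = j then q * k else 0)"
      using M[rule_format, OF h(1)[of i] h(1)[of j]] h(2)[of i] h(2)[of j] by (cases "i = j") auto
    finally show ?thesis .
  qed
  then show ?thesis using h(1) g_def by blast
qed

lemma all_less_12: "(\<forall>m<12::nat. P m) \<longleftrightarrow>
    P 0 \<and> P 1 \<and> P 2 \<and> P 3 \<and> P 4 \<and> P 5 \<and> P 6 \<and> P 7 \<and> P 8 \<and> P 9 \<and> P 10 \<and> P 11"
  by (simp only: eval_nat_numeral BitM.simps All_less_Suc not_less_zero simp_thms One_nat_def) blast

lemma nth_12:
  "[x0, x1, x2, x3, x4, x5, x6, x7, x8, x9, x10, x11] ! 0 = x0"
  "[x0, x1, x2, x3, x4, x5, x6, x7, x8, x9, x10, x11] ! 1 = x1"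
  "[x0, x1, x2, x3, x4, x5, x6, x7, x8, x9, x10, x11] ! 2 = x2"
  "[x0, x1, x2, x3, x4, x5, x6, x7, x8, x9, x10, x11] ! 3 = x3"
  "[x0, x1, x2, x3, x4, x5, x6, x7, x8, x9, x10, x11] ! 4 = x4"
  "[x0, x1, x2, x3, x4, x5, x6, x7, x8, x9, x10, x11] ! 5 = x5"
  "[x0, x1, x2, x3, x4, x5, x6, x7, x8, x9, x10, x11] ! 6 = x6"
  "[x0, x1, x2, x3, x4, x5, x6, x7, x8, x9, x10, x11] ! 7 = x7"
  "[x0, x1, x2, x3, x4, x5, x6, x7, x8, x9, x10, x11] ! 8 = x8"
  "[x0, x1, x2, x3, x4, x5, x6, x7, x8, x9, x10, x11] ! 9 = x9"
  "[x0, x1, x2, x3, x4, x5, x6, x7, x8, x9, x10, x11] ! 10 = x10"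
  "[x0, x1, x2, x3, x4, x5, x6, x7, x8, x9, x10, x11] ! 11 = x11"
  by simp_all

lemma dot_12:
  fixes x0 :: "'a :: semiring_0"
  shows "(\<Sum>t<12. [x0, x1, x2, x3, x4, x5, x6, x7, x8, x9, x10, x11] ! t *
      [y0, y1, y2, y3, y4, y5, y6, y7, y8, y9, y10, y11] ! t) =
    x0 * y0 + x1 * y1 + x2 * y2 + x3 * y3 + x4 * y4 + x5 * y5 +
    x6 * y6 + x7 * y7 + x8 * y8 + x9 * y9 + x10 * y10 + x11 * y11"
  by (simp add: eval_nat_numeral)

text \<open>Three diagonal blocks, each with the coordinates of \<open>q\<close>, \<open>iq\<close>,
  \<open>jq\<close>, \<open>kq\<close> as rows, where \<open>q = a + bi + cj + dk\<close>.\<close>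

definition quaternion_matrix :: "'a \<Rightarrow> 'a \<Rightarrow> 'a \<Rightarrow> 'a \<Rightarrow> 'a :: comm_ring_1 list list" where
  "quaternion_matrix a b c d = [[a, b, c, d, 0, 0, 0, 0, 0, 0, 0, 0],
      [- b, a, - d, c, 0, 0, 0, 0, 0, 0, 0, 0],
      [- c, d, a, - b, 0, 0, 0, 0, 0, 0, 0, 0],
      [- d, - c, b, a, 0, 0, 0, 0, 0, 0, 0, 0],
      [0, 0, 0, 0, a, b, c, d, 0, 0, 0, 0],
      [0, 0, 0, 0, - b, a, - d, c, 0, 0, 0, 0],
      [0, 0, 0, 0, - c, d, a, - b, 0, 0, 0, 0],
      [0, 0, 0, 0, - d, - c, b, a, 0, 0, 0, 0],
      [0, 0, 0, 0, 0, 0, 0, 0, a, b, c, d],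
      [0, 0, 0, 0, 0, 0, 0, 0, - b, a, - d, c],
      [0, 0, 0, 0, 0, 0, 0, 0, - c, d, a, - b],
      [0, 0, 0, 0, 0, 0, 0, 0, - d, - c, b, a]]"

lemma quaternion_matrix_orthogonal:
  fixes a b c d :: real
  defines "M \<equiv> quaternion_matrix a b c d"
  shows "\<forall>m<12. \<forall>n<12. (\<Sum>t<12. M ! m ! t * M ! n ! t) = (if m = n then a^2 + b^2 + c^2 + d^2 else 0)"
proof -
  have rows: "M ! 0 = [a, b, c, d, 0, 0, 0, 0, 0, 0, 0, 0]"
    "M ! 1 = [- b, a, - d, c, 0, 0, 0, 0, 0, 0, 0, 0]"
    "M ! 2 = [- c, d, a, - b, 0, 0, 0, 0, 0, 0, 0, 0]"
    "M ! 3 = [- d, - c, b, a, 0, 0, 0, 0, 0, 0, 0, 0]"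
    "M ! 4 = [0, 0, 0, 0, a, b, c, d, 0, 0, 0, 0]"
    "M ! 5 = [0, 0, 0, 0, - b, a, - d, c, 0, 0, 0, 0]"
    "M ! 6 = [0, 0, 0, 0, - c, d, a, - b, 0, 0, 0, 0]"
    "M ! 7 = [0, 0, 0, 0, - d, - c, b, a, 0, 0, 0, 0]"
    "M ! 8 = [0, 0, 0, 0, 0, 0, 0, 0, a, b, c, d]"
    "M ! 9 = [0, 0, 0, 0, 0, 0, 0, 0, - b, a, - d, c]"
    "M ! 10 = [0, 0, 0, 0, 0, 0, 0, 0, - c, d, a, - b]"
    "M ! 11 = [0, 0, 0, 0, 0, 0, 0, 0, - d, - c, b, a]"
    by (simp_all add: M_def quaternion_matrix_def)
  show ?thesis
    unfolding all_less_12 rows dot_12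
    apply (intro conjI)
    apply (simp_all only: refl if_True if_False numeral_eq_iff zero_neq_numeral numeral_neq_zero
      one_eq_numeral_iff numeral_eq_one_iff zero_neq_one one_neq_zero num.distinct num.inject)
    by (simp_all add: algebra_simps power2_eq_square)
qed

text \<open>The real form of the quaternionic matrix \<open>U C U*\<close>, where \<open>U = diag (1, \<omega>, \<omega>\<^sup>2)\<close> for a Hurwitz unit
  \<open>\<omega>\<close> of order 3 and \<open>C\<close> is the circulant of \<open>(-d + ai + bj + ck, 2d, 2d)\<close>. Without the
  conjugation the off-diagonal blocks would be scalar, with zero and even entries.\<close>

definition circulant_quaternion_matrix :: "'a \<Rightarrow> 'a \<Rightarrow> 'a \<Rightarrow> 'a \<Rightarrow> 'a :: comm_ring_1 list list" where
  "circulant_quaternion_matrix a b c d = [[- d, a, b, c, - d, - d, - d, - d, - d, d, d, d],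
      [- a, - d, - c, b, d, - d, d, - d, - d, - d, - d, d],
      [- b, c, - d, - a, d, - d, - d, d, - d, d, - d, - d],
      [- c, - b, a, - d, d, d, - d, - d, - d, - d, d, - d],
      [- d, d, d, d, - d, b, c, a, - d, - d, - d, - d],
      [- d, - d, - d, d, - b, - d, - a, c, d, - d, d, - d],
      [- d, d, - d, - d, - c, a, - d, - b, d, - d, - d, d],
      [- d, - d, d, - d, - a, - c, b, - d, d, d, - d, - d],
      [- d, - d, - d, - d, - d, d, d, d, - d, c, a, b],
      [d, - d, d, - d, - d, - d, - d, d, - c, - d, - b, a],
      [d, - d, - d, d, - d, d, - d, - d, - a, b, - d, - c],
      [d, d, - d, - d, - d, - d, d, - d, - b, - a, c, - d]]"

text \<open>With the pure quaternion \<open>q = ai + bj + ck\<close>, a block row of the circulant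
  has norm \<open>(d^2 + |q|^2) + 4 d^2 + 4 d^2\<close>, and two different block rows have product
  \<open>2d(-d + q) + 2d(-d - q) + 4d^2 = 0\<close>. Conjugation by a unitary diagonal matrix
  preserves both.\<close>

lemma circulant_quaternion_matrix_orthogonal:
  fixes a b c d :: real
  defines "M \<equiv> circulant_quaternion_matrix a b c d"
  shows "\<forall>m<12. \<forall>n<12. (\<Sum>t<12. M ! m ! t * M ! n ! t) = (if m = n then a^2 + b^2 + c^2 + 9 * d^2 else 0)"
proof -
  have rows: "M ! 0 = [- d, a, b, c, - d, - d, - d, - d, - d, d, d, d]"
    "M ! 1 = [- a, - d, - c, b, d, - d, d, - d, - d, - d, - d, d]"
    "M ! 2 = [- b, c, - d, - a, d, - d, - d, d, - d, d, - d, - d]"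
    "M ! 3 = [- c, - b, a, - d, d, d, - d, - d, - d, - d, d, - d]"
    "M ! 4 = [- d, d, d, d, - d, b, c, a, - d, - d, - d, - d]"
    "M ! 5 = [- d, - d, - d, d, - b, - d, - a, c, d, - d, d, - d]"
    "M ! 6 = [- d, d, - d, - d, - c, a, - d, - b, d, - d, - d, d]"
    "M ! 7 = [- d, - d, d, - d, - a, - c, b, - d, d, d, - d, - d]"
    "M ! 8 = [- d, - d, - d, - d, - d, d, d, d, - d, c, a, b]"
    "M ! 9 = [d, - d, d, - d, - d, - d, - d, d, - c, - d, - b, a]"
    "M ! 10 = [d, - d, - d, d, - d, d, - d, - d, - a, b, - d, - c]"
    "M ! 11 = [d, d, - d, - d, - d, - d, d, - d, - b, - a, c, - d]"
    by (simp_all add: M_def circulant_quaternion_matrix_def)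
  show ?thesis
    unfolding all_less_12 rows dot_12
    apply (intro conjI)
    apply (simp_all only: refl if_True if_False numeral_eq_iff zero_neq_numeral numeral_neq_zero
      one_eq_numeral_iff numeral_eq_one_iff zero_neq_one one_neq_zero num.distinct num.inject)
    by (simp_all add: algebra_simps power2_eq_square)
qed

section \<open>Self-dual sets as additive groups, and multiples of frames\<close>

lemma self_dual_inner_Ints: "L = dual_lattice L \<Longrightarrow> x \<in> L \<Longrightarrow> y \<in> L \<Longrightarrow> x \<bullet> y \<in> \<int>"
  unfolding dual_lattice_def by blast

lemma self_dual_memI: "L = dual_lattice L \<Longrightarrow> (\<And>y. y \<in> L \<Longrightarrow> x \<bullet> y \<in> \<int>) \<Longrightarrow> x \<in> L"
  unfolding dual_lattice_def by blast

lemma self_dual_add: "L = dual_lattice L \<Longrightarrow> x \<in> L \<Longrightarrow> y \<in> L \<Longrightarrow> x + y \<in> L"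
  by (rule self_dual_memI) (auto simp: inner_add_left intro: Ints_add self_dual_inner_Ints)

lemma self_dual_diff: "L = dual_lattice L \<Longrightarrow> x \<in> L \<Longrightarrow> y \<in> L \<Longrightarrow> x - y \<in> L"
  by (rule self_dual_memI) (auto simp: inner_diff_left intro: Ints_diff self_dual_inner_Ints)

lemma self_dual_scaleR: "L = dual_lattice L \<Longrightarrow> x \<in> L \<Longrightarrow> c \<in> \<int> \<Longrightarrow> c *\<^sub>R x \<in> L"
  by (rule self_dual_memI) (auto intro: Ints_mult self_dual_inner_Ints)

lemma self_dual_zero: "L = dual_lattice L \<Longrightarrow> 0 \<in> L"
  by (rule self_dual_memI) auto

lemma self_dual_sum: "L = dual_lattice L \<Longrightarrow> (\<And>i. i \<in> A \<Longrightarrow> f i \<in> L) \<Longrightarrow> sum f A \<in> L"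
  by (induction A rule: infinite_finite_induct) (auto simp: self_dual_zero intro: self_dual_add)

lemma bij_betw_lessThan_12: "\<exists>e. bij_betw e {..<12::nat} (UNIV :: 12 set)"
  using ex_bij_betw_nat_finite[of "UNIV :: 12 set"] by (simp add: atLeast0LessThan)

lemma contains_frame_mult_four_squares:
  fixes L :: "(real ^ 12) set"
  assumes L: "L = dual_lattice L" and k: "contains_frame k L"
    and q: "int q = a^2 + b^2 + c^2 + d^2"
  shows "contains_frame (q * k) L"
proof -
  obtain f :: "12 \<Rightarrow> real ^ 12" where f: "\<forall>i. f i \<in> L" "\<forall>i j. f i \<bullet> f j = (if i = j then real k else 0)"
    using k unfolding contains_frame_def is_frame_def by blast
  obtain e where e: "bij_betw e {..<12::nat} (UNIV :: 12 set)" using bij_betw_lessThan_12 by blast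
  define M where "M = quaternion_matrix (real_of_int a) (of_int b) (of_int c) (of_int d)"
  have q': "(real_of_int a)^2 + (of_int b)^2 + (of_int c)^2 + (of_int d)^2 = real q"
    using arg_cong[OF q, of real_of_int] by simp
  have "\<forall>m<12. \<forall>n<12. (\<Sum>t<12. M ! m ! t * M ! n ! t) = (if m = n then real q else 0)"
    using quaternion_matrix_orthogonal[of "of_int a" "of_int b" "of_int c" "of_int d"] unfolding M_def q' .
  from combination_of_frame[OF f(2)[rule_format] this e] obtain g :: "12 \<Rightarrow> real ^ 12" where
    g: "\<forall>i. \<exists>m<12. g i = (\<Sum>t<12. (M ! m ! t) *\<^sub>R f (e t))" "\<forall>i j. g i \<bullet> g j = (if i = j then real q * real k else 0)"
    by blast
  have "\<forall>m<12. \<forall>t<12. M ! m ! t \<in> \<int>"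
    unfolding M_def quaternion_matrix_def all_less_12 nth_12 by (intro conjI) simp_all
  then have "g i \<in> L" for i
    using g(1)[rule_format, of i] f(1) L by (auto intro!: self_dual_sum self_dual_scaleR)
  then show ?thesis
    unfolding contains_frame_def is_frame_def using g(2) by (intro exI[of _ g]) auto
qed

text \<open>One prime factor of \<open>n\<close> is split off at a time, since each prime is a sum
  of four squares.\<close>

lemma contains_frame_mult:
  fixes L :: "(real ^ 12) set"
  assumes L: "L = dual_lattice L" and k: "contains_frame k L"
  shows "n > 0 \<Longrightarrow> contains_frame (n * k) L"
proof (induction n rule: less_induct)
  case (less n)
  show ?case
  proof (cases "n = 1")
    case False
    then obtain p where p: "prime p" "p dvd n" using prime_factor_nat by blast
    then obtain m where m: "n = p * m" by blast
    have "m < n" "m > 0" using m less.prems prime_gt_1_nat[OF p(1)] by auto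
    then have "contains_frame (m * k) L" using less.IH by simp
    then show ?thesis
      using contains_frame_mult_four_squares[OF L] prime_sum_of_four_squares[OF p(1)] m
      by (metis mult.assoc)
  qed (use k in simp)
qed

lemma sum_12: "(\<Sum>t<12::nat. f t) =
    (f 0 + f 1 + f 2 + f 3 + f 4 + f 5 + f 6 + f 7 + f 8 + f 9 + f 10 + f 11 :: 'a :: comm_monoid_add)"
  by (simp add: eval_nat_numeral)

lemma circulant_quaternion_matrix_of_int:
  "\<forall>m<12. \<forall>t<12. circulant_quaternion_matrix (of_int a) (of_int b) (of_int c) (of_int d) ! m ! t
    = (of_int (circulant_quaternion_matrix a b c d ! m ! t) :: real)"
  unfolding circulant_quaternion_matrix_def all_less_12 nth_12 by simp

lemma circulant_quaternion_matrix_odd: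
  fixes a b c d :: int
  assumes "odd a" "odd b" "odd c" "odd d"
  shows "\<forall>m<12. \<forall>t<12. odd (circulant_quaternion_matrix a b c d ! m ! t)"
  unfolding circulant_quaternion_matrix_def all_less_12 nth_12 by (simp add: assms)

text \<open>When the variables are 1 modulo 4, a row sum is congruent to 12 minus twice the number
  of minus signs, and each row has six or eight of these.\<close>

lemma circulant_quaternion_matrix_row_sum:
  fixes a b c d :: int
  assumes "a mod 4 = 1" "b mod 4 = 1" "c mod 4 = 1" "d mod 4 = 1"
  shows "\<forall>m<12. 4 dvd (\<Sum>t<12. circulant_quaternion_matrix a b c d ! m ! t)"
proof -
  obtain a' b' c' d' where "a = 4 * a' + 1" "b = 4 * b' + 1" "c = 4 * c' + 1" "d = 4 * d' + 1"
    using assms by (metis mult_div_mod_eq)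
  then show ?thesis
    unfolding circulant_quaternion_matrix_def all_less_12 sum_12 nth_12 by presburger
qed

lemma contains_frame_odd_prime:
  fixes L :: "(real ^ 12) set" and u :: "12 \<Rightarrow> real ^ 12"
  assumes u: "\<And>i j. u i \<bullet> u j = (if i = j then 1 else 0)"
    and spin: "\<And>y :: 12 \<Rightarrow> int. (\<And>i. odd (y i)) \<Longrightarrow> 4 dvd (\<Sum>i\<in>UNIV. y i) \<Longrightarrow>
      (1/2) *\<^sub>R (\<Sum>i\<in>UNIV. of_int (y i) *\<^sub>R u i) \<in> L"
    and p: "prime p" "odd p"
  shows "contains_frame p L"
proof -
  obtain s1 s2 s3 s4 :: int where s: "int p = s1^2 + s2^2 + s3^2 + s4^2"
    using prime_sum_of_four_squares[OF p(1)] by blast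
  have nsq: "int p \<noteq> m^2" for m :: int
  proof
    assume "int p = m^2"
    then have "int p = int (nat \<bar>m\<bar> ^ 2)" by simp
    then have "p = nat \<bar>m\<bar> ^ 2" by (simp only: of_nat_eq_iff)
    then show False using p(1) prime_power_iff[of "nat \<bar>m\<bar>" 2] by simp
  qed
  have "int p = 3 \<or> \<not> 3 dvd int p"
  proof -
    have "3 dvd p \<Longrightarrow> p = 3" using p(1) primes_dvd_imp_eq[of 3 p] by simp
    then show ?thesis using int_dvd_int_iff[of 3 p] by auto
  qed
  then have "odd_rep (int p)"
    using odd_rep_sum_of_four_squares[OF s _ nsq] p(2) by simp
  then obtain a b c d :: int where o: "odd a" "odd b" "odd c" "odd d" and abcd: "4 * int p = a^2 + b^2 + c^2 + 9 * d^2"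
    unfolding odd_rep_def by blast
  \<comment> \<open>Only squares enter the norm, so signs are free. They are chosen to make the row
    sums divisible by 4, as \<open>spin\<close> requires.\<close>
  have norm: "\<exists>y::int. y^2 = x^2 \<and> y mod 4 = 1 \<and> odd y" if "odd x" for x :: int
  proof (cases "x mod 4 = 1")
    case False
    with that have "(- x) mod 4 = 1" by presburger
    then show ?thesis using that by (intro exI[of _ "- x"]) auto
  qed (use that in auto)
  obtain a' b' c' d' where sq: "a'^2 = a^2" "b'^2 = b^2" "c'^2 = c^2" "d'^2 = d^2"
    and m: "a' mod 4 = 1" "b' mod 4 = 1" "c' mod 4 = 1" "d' mod 4 = 1"
    and o': "odd a'" "odd b'" "odd c'" "odd d'"
    using norm[OF o(1)] norm[OF o(2)] norm[OF o(3)] norm[OF o(4)] by auto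
  obtain e where e: "bij_betw e {..<12::nat} (UNIV :: 12 set)" using bij_betw_lessThan_12 by blast
  define M where "M = circulant_quaternion_matrix (real_of_int a') (of_int b') (of_int c') (of_int d')"
  define N where "N = circulant_quaternion_matrix a' b' c' d'"
  have q': "(real_of_int a')^2 + (of_int b')^2 + (of_int c')^2 + 9 * (of_int d')^2 = 4 * real p"
    using arg_cong[OF abcd, of real_of_int] by (simp flip: sq)
  have "\<forall>m<12. \<forall>n<12. (\<Sum>t<12. M ! m ! t * M ! n ! t) = (if m = n then 4 * real p else 0)"
    using circulant_quaternion_matrix_orthogonal[of "of_int a'" "of_int b'" "of_int c'" "of_int d'"] unfolding M_def q' .
  from combination_of_frame[OF u this e] obtain g :: "12 \<Rightarrow> real ^ 12" where
    g: "\<forall>i. \<exists>m<12. g i = (\<Sum>t<12. (M ! m ! t) *\<^sub>R u (e t))" "\<forall>i j. g i \<bullet> g j = (if i = j then 4 * real p * 1 else 0)"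
    by blast
  define h where "h = inv_into {..<12} e"
  have h: "h i < 12" for i
    using bij_betwE[OF bij_betw_inv_into[OF e]] by (auto simp: h_def)
  have he: "h (e t) = t" if "t < 12" for t
    using bij_betw_inv_into_left[OF e] that by (simp add: h_def)
  have "(1/2) *\<^sub>R g i \<in> L" for i
  proof -
    obtain m where m12: "m < 12" and gi: "g i = (\<Sum>t<12. (M ! m ! t) *\<^sub>R u (e t))" using g(1) by blast
    have "(1/2) *\<^sub>R (\<Sum>i\<in>UNIV. of_int (N ! m ! h i) *\<^sub>R u i) \<in> L"
    proof (rule spin)
      show "odd (N ! m ! h i)" for i
        using circulant_quaternion_matrix_odd[OF o'] m12 h by (simp add: N_def)
      have "(\<Sum>i\<in>UNIV. N ! m ! h i) = (\<Sum>t<12. N ! m ! t)"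
        using sum.reindex_bij_betw[OF e, of "\<lambda>i. N ! m ! h i"] he by simp
      then show "4 dvd (\<Sum>i\<in>UNIV. N ! m ! h i)"
        using circulant_quaternion_matrix_row_sum[OF m] m12 by (simp add: N_def)
    qed
    also have "(\<Sum>i\<in>UNIV. of_int (N ! m ! h i) *\<^sub>R u i) = (\<Sum>t<12. of_int (N ! m ! t) *\<^sub>R u (e t))"
      using sum.reindex_bij_betw[OF e, of "\<lambda>i. of_int (N ! m ! h i) *\<^sub>R u i"] he by simp
    also have "\<dots> = g i"
      using circulant_quaternion_matrix_of_int[of a' b' c' d'] m12 by (simp add: gi M_def N_def)
    finally show ?thesis .
  qed
  then show ?thesis
    unfolding contains_frame_def is_frame_def using g(2) by (intro exI[of _ "\<lambda>i. (1/2) *\<^sub>R g i"]) auto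
qed

lemma contains_frame_ge_2:
  fixes L :: "(real ^ 12) set" and u :: "12 \<Rightarrow> real ^ 12"
  assumes L: "L = dual_lattice L" and 2: "contains_frame 2 L"
    and u: "\<And>i j. u i \<bullet> u j = (if i = j then 1 else 0)"
    and spin: "\<And>y :: 12 \<Rightarrow> int. (\<And>i. odd (y i)) \<Longrightarrow> 4 dvd (\<Sum>i\<in>UNIV. y i) \<Longrightarrow>
      (1/2) *\<^sub>R (\<Sum>i\<in>UNIV. of_int (y i) *\<^sub>R u i) \<in> L"
    and k: "k \<ge> 2"
  shows "contains_frame k L"
proof -
  obtain p where p: "prime p" "p dvd k" using k prime_factor_nat[of k] by auto
  then obtain m where m: "k = m * p" by (metis dvdE mult.commute)
  have "contains_frame p L"
  proof (cases "odd p")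
    case True
    then show ?thesis using contains_frame_odd_prime[OF u spin p(1)] by blast
  next
    case False
    then have "p = 2" using p(1) primes_dvd_imp_eq two_is_prime_nat by blast
    then show ?thesis using 2 by simp
  qed
  then show ?thesis
    using contains_frame_mult[OF L, of p m] m k by (cases "m = 0") auto
qed

section \<open>From a 2-frame to an orthonormal basis\<close>

text \<open>Parseval's identity: the matrix with rows \<open>u i\<close> is orthogonal, so it
  preserves inner products.\<close>

lemma orthonormal_family_inner:
  fixes u :: "'n \<Rightarrow> real ^ 'n"
  assumes u: "\<And>i j. u i \<bullet> u j = (if i = j then 1 else 0)"
  shows "x \<bullet> y = (\<Sum>i\<in>UNIV. (x \<bullet> u i) * (y \<bullet> u i))"
proof -
  define U :: "real ^ 'n ^ 'n" where "U = (\<chi> i. u i)"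
  have "U ** transpose U = mat 1"
    using u by (simp add: matrix_matrix_mult_def mat_def transpose_def U_def vec_eq_iff inner_vec_def)
  then have "orthogonal_matrix U"
    unfolding orthogonal_matrix_def by (metis matrix_left_right_inverse)
  then have "orthogonal_transformation ((*v) U)"
    using orthogonal_transformation_matrix[of "(*v) U"] by simp
  then have "(U *v x) \<bullet> (U *v y) = x \<bullet> y"
    by (simp add: orthogonal_transformation_def)
  moreover have "(U *v x) $ i = x \<bullet> u i" for x i
    by (simp add: matrix_vector_mul_component U_def inner_commute)
  ultimately show ?thesis
    by (simp add: inner_vec_def)
qed

section \<open>Binary codes as families of sets closed under symmetric difference\<close>

lemma even_card_sym_diff_Int:
  fixes S T U :: "'a :: finite set"
  shows "even (card ((S - T \<union> (T - S)) \<inter> U)) \<longleftrightarrow> (even (card (S \<inter> U)) \<longleftrightarrow> even (card (T \<inter> U)))"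
proof -
  have "card ((S - T \<union> (T - S)) \<inter> U) = card ((S - T) \<inter> U) + card ((T - S) \<inter> U)"
    by (subst card_Un_disjoint[symmetric]) (auto intro: arg_cong[of _ _ card])
  moreover have "card (S \<inter> U) = card ((S - T) \<inter> U) + card (S \<inter> T \<inter> U)"
    by (subst card_Un_disjoint[symmetric]) (auto intro: arg_cong[of _ _ card])
  moreover have "card (T \<inter> U) = card ((T - S) \<inter> U) + card (S \<inter> T \<inter> U)"
    by (subst card_Un_disjoint[symmetric]) (auto intro: arg_cong[of _ _ card])
  ultimately show ?thesis by auto
qed

lemma card_sym_diff:
  fixes S T :: "'a :: finite set"
  shows "int (card (S - T \<union> (T - S))) = int (card S) + int (card T) - 2 * int (card (S \<inter> T))"
proof -
  have "card (S - T \<union> (T - S)) = card (S - T) + card (T - S)"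
    by (rule card_Un_disjoint) auto
  moreover have "card S = card (S - T) + card (S \<inter> T)"
    by (subst card_Un_disjoint[symmetric]) (auto intro: arg_cong[of _ _ card])
  moreover have "card T = card (T - S) + card (S \<inter> T)"
    by (subst card_Un_disjoint[symmetric]) (auto intro: arg_cong[of _ _ card])
  ultimately show ?thesis by simp
qed

text \<open>The coordinate characters of the group of sets under symmetric difference.\<close>

definition sgn_mem :: "'a \<Rightarrow> 'a set \<Rightarrow> int" where
  "sgn_mem k S = (if k \<in> S then -1 else 1)"

text \<open>Translation by \<open>T\<close> permutes \<open>C\<close> and negates every value of the
  character \<open>f\<close>.\<close>

lemma character_sum_zero:
  fixes f :: "'a :: finite set \<Rightarrow> int"
  assumes closed: "\<And>S T. S \<in> C \<Longrightarrow> T \<in> C \<Longrightarrow> S - T \<union> (T - S) \<in> C"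
    and mult: "\<And>S T. S \<in> C \<Longrightarrow> T \<in> C \<Longrightarrow> f (S - T \<union> (T - S)) = f S * f T"
    and T: "T \<in> C" "f T = -1"
  shows "sum f C = 0"
proof -
  define g where "g = (\<lambda>S. S - T \<union> (T - S))"
  have gg: "g (g S) = S" for S by (auto simp: g_def)
  have gC: "g S \<in> C" if "S \<in> C" for S unfolding g_def using closed[OF that T(1)] .
  have "bij_betw g C C"
    by (rule bij_betw_byWitness[where f' = g]) (auto simp: gg gC)
  then have "sum f C = (\<Sum>S\<in>C. f (g S))"
    by (rule sum.reindex_bij_betw[symmetric])
  also have "\<dots> = (\<Sum>S\<in>C. - f S)"
    using mult T by (intro sum.cong) (auto simp: g_def)
  finally show ?thesis by (simp add: sum_negf)
qed

lemma sum_sgn_mem: "(\<Sum>k\<in>UNIV. sgn_mem k S) = int CARD('a) - 2 * int (card (S :: 'a :: finite set))"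
proof -
  have "(\<Sum>k\<in>UNIV. sgn_mem k S) = (\<Sum>k\<in>UNIV. 1 - 2 * (if k \<in> S then 1 else 0))"
    by (intro sum.cong) (auto simp: sgn_mem_def)
  also have "\<dots> = int CARD('a) - 2 * (\<Sum>k\<in>UNIV. (if k \<in> S then 1 else 0))"
    by (simp add: sum_subtractf sum_distrib_left)
  finally show ?thesis by (simp add: sum.If_cases)
qed

text \<open>The factor \<open>12 - 2|S|\<close> vanishes on the words of weight 6, the only ones on which the
  character \<open>(-1)^(|S|/2)\<close> is not 1, so twisting a coordinate character by it leaves its
  correlation with \<open>12 - 2|S|\<close>, the sum of all coordinate characters, unchanged.\<close>

lemma code_partner_exists:
  fixes C :: "12 set set" and i :: 12
  assumes closed: "\<And>S T. S \<in> C \<Longrightarrow> T \<in> C \<Longrightarrow> S - T \<union> (T - S) \<in> C"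
    and empty: "{} \<in> C"
    and orth: "\<And>S T. S \<in> C \<Longrightarrow> T \<in> C \<Longrightarrow> even (card (S \<inter> T))"
    and weights: "\<And>S. S \<in> C \<Longrightarrow> card S \<in> {0, 4, 6, 8, 12}"
    and sep: "\<And>k l. k \<noteq> l \<Longrightarrow> \<exists>S\<in>C. (k \<in> S) \<noteq> (l \<in> S)"
  shows "\<exists>k. \<forall>S\<in>C. (i \<in> S) \<noteq> (k \<in> S) \<longleftrightarrow> card S = 6"
proof (rule ccontr)
  assume neg: "\<not> ?thesis"
  define h :: "12 set \<Rightarrow> int" where "h S = (if card S = 6 then -1 else 1)" for S
  have sgn_mult: "sgn_mem k (S - T \<union> (T - S)) = sgn_mem k S * sgn_mem k T" for k and S T :: "12 set"
    by (auto simp: sgn_mem_def)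
  \<comment> \<open>\<open>h\<close> is a character: since intersections are even, the size of a
    symmetric difference is the sum of the sizes modulo 4, and 6 is the only admissible weight not
    divisible by 4.\<close>
  have h_mult: "h (S - T \<union> (T - S)) = h S * h T" if ST: "S \<in> C" "T \<in> C" for S T
  proof -
    obtain c where c: "int (card (S \<inter> T)) = 2 * c" using orth[OF ST] by (metis dvdE even_of_nat)
    have six: "h S = (if 4 dvd int (card S) then 1 else -1)" if "S \<in> C" for S
      using weights[OF that] by (auto simp: h_def)
    have "int (card (S - T \<union> (T - S))) = int (card S) + int (card T) - 4 * c"
      using card_sym_diff[of S T] c by simp
    moreover have "even (int (card S))" "even (int (card T))" using weights[OF ST(1)] weights[OF ST(2)] by auto
    ultimately have "4 dvd int (card (S - T \<union> (T - S))) \<longleftrightarrow> (4 dvd int (card S) \<longleftrightarrow> 4 dvd int (card T))"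
      by presburger
    then show ?thesis
      using six[OF closed[OF ST]] six[OF ST(1)] six[OF ST(2)] by auto
  qed
  \<comment> \<open>Orthogonality of the coordinate characters, which are distinct on
    \<open>C\<close> by \<open>sep\<close>. Summed over \<open>k\<close> it correlates character
    \<open>i\<close> with \<open>12 - 2|S|\<close>.\<close>
  have "(\<Sum>S\<in>C. sgn_mem i S * sgn_mem k S) = (if k = i then int (card C) else 0)" for k
  proof (cases "k = i")
    case True
    have "sgn_mem i S * sgn_mem i S = 1" for S by (simp add: sgn_mem_def)
    then show ?thesis using True by simp
  next
    case False
    obtain T where "T \<in> C" "(k \<in> T) \<noteq> (i \<in> T)" using sep[OF False] by blast
    then have "(\<Sum>S\<in>C. sgn_mem i S * sgn_mem k S) = 0"
      by (intro character_sum_zero[of C _ T] closed) (auto simp: sgn_mult, auto simp: sgn_mem_def)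
    then show ?thesis using False by simp
  qed
  then have "(\<Sum>k\<in>UNIV. \<Sum>S\<in>C. sgn_mem i S * sgn_mem k S) = int (card C)"
    by simp
  then have "(\<Sum>S\<in>C. sgn_mem i S * (\<Sum>k\<in>UNIV. sgn_mem k S)) = int (card C)"
    by (subst (asm) sum.swap) (simp add: sum_distrib_left)
  moreover have "(\<Sum>S\<in>C. sgn_mem i S * (\<Sum>k\<in>UNIV. sgn_mem k S)) = (\<Sum>S\<in>C. h S * sgn_mem i S * (\<Sum>k\<in>UNIV. sgn_mem k S))"
    by (intro sum.cong refl) (auto simp: sum_sgn_mem h_def)
  moreover have "\<dots> = (\<Sum>k\<in>UNIV. \<Sum>S\<in>C. h S * sgn_mem i S * sgn_mem k S)"
    by (subst sum.swap) (simp add: sum_distrib_left)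
  \<comment> \<open>If \<open>i\<close> had no partner, each twisted product would be a nontrivial
    character, and the same correlation would come out as 0 instead of
    \<open>card C\<close>.\<close>
  moreover have "(\<Sum>S\<in>C. h S * sgn_mem i S * sgn_mem k S) = 0" for k
  proof -
    obtain T where T: "T \<in> C" "((i \<in> T) \<noteq> (k \<in> T)) \<noteq> (card T = 6)" using neg by blast
    have "h T * sgn_mem i T * sgn_mem k T = -1"
      using T(2) by (auto simp: h_def sgn_mem_def)
    with T(1) show ?thesis
      by (intro character_sum_zero[of C _ T] closed) (simp_all add: sgn_mult h_mult)
  qed
  ultimately have "card C = 0" by simp
  then show False using empty by simp
qed

text \<open>The norm of \<open>x\<close> is odd exactly when the word \<open>T x\<close> of its odd
  coordinates has weight 6, and then \<open>T x\<close> separates each coordinate from its partner.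
  Half sums and half differences of partnered frame vectors hence have inner products with
  \<open>x\<close> that are integral or half-odd according to the parity of the norm.\<close>

lemma frame_to_orthonormal:
  fixes L :: "(real ^ 12) set" and r :: "12 \<Rightarrow> real ^ 12"
  assumes L: "L = dual_lattice L" and min: "\<And>x. x \<in> L \<Longrightarrow> x \<noteq> 0 \<Longrightarrow> 2 \<le> x \<bullet> x"
    and x0: "x0 \<in> L" "x0 \<bullet> x0 = of_int m0" "odd m0"
    and rL: "\<And>i. r i \<in> L" and r: "\<And>i j. r i \<bullet> r j = (if i = j then 2 else 0)"
  shows "\<exists>u :: 12 \<Rightarrow> real ^ 12. (\<forall>i j. u i \<bullet> u j = (if i = j then 1 else 0)) \<and>
    (\<forall>x\<in>L. \<forall>i. \<exists>m n :: int. 2 * (x \<bullet> u i) = of_int m \<and> x \<bullet> x = of_int n \<and> (even m \<longleftrightarrow> even n))"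
proof -
  define h :: "12 set \<Rightarrow> real ^ 12" where "h S = (1/2) *\<^sub>R (\<Sum>i\<in>S. r i)" for S
  define C where "C = {S. h S \<in> L}"
  define n where "n x i = \<lfloor>x \<bullet> r i\<rfloor>" for x i
  define T where "T x = {i. odd (n x i)}" for x
  have n: "x \<bullet> r i = of_int (n x i)" if "x \<in> L" for x i
    using self_dual_inner_Ints[OF L that rL] by (simp add: n_def)
  have hr: "h S \<bullet> r i = (if i \<in> S then 1 else 0)" for S i
    by (simp add: h_def inner_sum_left r sum.delta)
  have inner: "x \<bullet> y = (\<Sum>i\<in>UNIV. (x \<bullet> r i) * (y \<bullet> r i)) / 2" for x y
  proof -
    have "((1 / sqrt 2) *\<^sub>R r i) \<bullet> ((1 / sqrt 2) *\<^sub>R r j) = (if i = j then 1 else 0)" for i j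
      by (simp add: r)
    from orthonormal_family_inner[OF this, of x y] show ?thesis
      by (simp add: sum_divide_distrib mult.commute mult.left_commute)
  qed
  have hh: "h S \<bullet> h S' = real (card (S \<inter> S')) / 2" for S S'
  proof -
    have "h S \<bullet> h S' = (\<Sum>i\<in>UNIV. if i \<in> S \<inter> S' then 1 else 0) / 2"
      by (subst inner) (auto simp: hr intro!: sum.cong)
    then show ?thesis by (simp add: sum.If_cases Int_def)
  qed
  have hx: "h S \<bullet> x = (\<Sum>i\<in>S. of_int (n x i)) / 2" if "x \<in> L" for S x
    using n[OF that] by (simp add: h_def inner_commute[of _ x] inner_sum_right)
  \<comment> \<open>\<open>x - h (T x)\<close> has even coordinates against the frame, so it pairs
    integrally with \<open>L\<close>; as \<open>x\<close> does too, so does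
    \<open>h (T x)\<close>.\<close>
  have TC: "T x \<in> C" if x: "x \<in> L" for x
  proof -
    have "h (T x) \<bullet> y \<in> \<int>" if y: "y \<in> L" for y
    proof -
      have "x \<bullet> y - h (T x) \<bullet> y = (\<Sum>i\<in>UNIV. (of_int (n x i) - (if i \<in> T x then 1 else 0)) * of_int (n y i)) / 2"
        unfolding inner[of x y] inner[of "h (T x)" y] hr n[OF x] n[OF y]
        by (simp add: sum_subtractf diff_divide_distrib left_diff_distrib)
      also have "\<dots> = (\<Sum>i\<in>UNIV. (of_int ((n x i - (if i \<in> T x then 1 else 0)) * n y i) / 2))"
        unfolding sum_divide_distrib by (intro sum.cong) auto
      also have "\<dots> \<in> \<int>"
      proof (rule Ints_sum)
        fix i
        have "even ((n x i - (if i \<in> T x then 1 else 0)) * n y i)" by (auto simp: T_def)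
        then obtain c where "(n x i - (if i \<in> T x then 1 else 0)) * n y i = 2 * c" by blast
        then show "real_of_int ((n x i - (if i \<in> T x then 1 else 0)) * n y i) / 2 \<in> \<int>" by simp
      qed
      finally show ?thesis
        using self_dual_inner_Ints[OF L x y] by (metis Ints_diff diff_diff_eq2 add_diff_cancel_left')
    qed
    then show ?thesis unfolding C_def using self_dual_memI[OF L] by blast
  qed
  have orth: "even (card (S \<inter> S'))" if "S \<in> C" "S' \<in> C" for S S'
  proof -
    have "real (card (S \<inter> S')) / 2 \<in> \<int>"
      using self_dual_inner_Ints[OF L, of "h S" "h S'"] that by (simp add: C_def hh)
    then obtain c where "real (card (S \<inter> S')) / 2 = of_int c" by (rule Ints_cases)
    then have "real_of_int (int (card (S \<inter> S'))) = of_int (2 * c)" by simp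
    then have "int (card (S \<inter> S')) = 2 * c" by (simp only: of_int_eq_iff)
    then show ?thesis by (metis dvd_triv_left even_of_nat)
  qed
  have selfdual: "S \<in> C" if "\<And>S'. S' \<in> C \<Longrightarrow> even (card (S \<inter> S'))" for S
  proof -
    have "h S \<bullet> x \<in> \<int>" if x: "x \<in> L" for x
    proof -
      have "even (\<Sum>i\<in>S. n x i)"
        using \<open>\<And>S'. S' \<in> C \<Longrightarrow> even (card (S \<inter> S'))\<close>[OF TC[OF x]] by (simp add: even_sum_iff T_def Int_def)
      then obtain c where "(\<Sum>i\<in>S. n x i) = 2 * c" by blast
      then have "real_of_int (\<Sum>i\<in>S. n x i) = of_int (2 * c)" by (simp only:)
      then show ?thesis by (simp add: hx[OF x])
    qed
    then show ?thesis unfolding C_def using self_dual_memI[OF L] by blast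
  qed
  have closed: "S - S' \<union> (S' - S) \<in> C" if "S \<in> C" "S' \<in> C" for S S'
    by (rule selfdual) (use that orth in \<open>auto simp: even_card_sym_diff_Int\<close>)
  \<comment> \<open>\<open>h S\<close> has norm \<open>card S / 2\<close>, which the minimum norm
    bounds below by 2.\<close>
  have ge4: "card S \<ge> 4" if "S \<in> C" "S \<noteq> {}" for S
  proof -
    have "card S > 0" using that by (simp add: card_gt_0_iff)
    then have "h S \<noteq> 0" using hh[of S S] by auto
    then show ?thesis using min[of "h S"] that hh[of S S] by (simp add: C_def)
  qed
  have UC: "UNIV \<in> C" by (rule selfdual) (use orth in force)
  have weights: "card S \<in> {0, 4, 6, 8, 12}" if S: "S \<in> C" for S
  proof -
    have e: "even (card S)" using orth[OF S S] by simp
    have le: "card S \<le> 12" using card_mono[of "UNIV :: 12 set" S] by simp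
    have "- S \<in> C" using closed[OF UC S] by (simp add: Compl_eq_Diff_UNIV)
    then have "card (- S) = 0 \<or> card (- S) \<ge> 4" using ge4[of "- S"] by fastforce
    moreover have "card (- S) = 12 - card S" by (simp add: Compl_eq_Diff_UNIV card_Diff_subset)
    moreover have "card S = 0 \<or> card S \<ge> 4" using ge4[OF S] by fastforce
    ultimately have "card S = 0 \<or> card S = 12 \<or> 4 \<le> card S \<and> card S \<le> 8" using le by linarith
    then have "card S \<in> {0, 12, 4, 5, 6, 7, 8}" by auto
    then show ?thesis using e by auto
  qed
  \<comment> \<open>If all words agreed on \<open>k\<close> and \<open>l\<close>, self-duality would
    make \<open>{k, l}\<close> a word of weight 2.\<close>
  have sep: "\<exists>S\<in>C. (k \<in> S) \<noteq> (l \<in> S)" if "k \<noteq> l" for k l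
  proof (rule ccontr)
    assume *: "\<not> ?thesis"
    have "{k, l} \<in> C"
    proof (rule selfdual)
      fix S assume "S \<in> C"
      then have "{k, l} \<inter> S = {} \<or> {k, l} \<inter> S = {k, l}" using * by auto
      then show "even (card ({k, l} \<inter> S))" using that by auto
    qed
    then show False using ge4[of "{k, l}"] that by simp
  qed
  have "\<exists>k. \<forall>S\<in>C. (i \<in> S) \<noteq> (k \<in> S) \<longleftrightarrow> card S = 6" for i
    by (rule code_partner_exists[OF closed _ orth weights sep]) (simp_all add: selfdual)
  then obtain \<sigma> where \<sigma>: "\<And>i S. S \<in> C \<Longrightarrow> (i \<in> S) \<noteq> (\<sigma> i \<in> S) \<longleftrightarrow> card S = 6"
    by metis
  have norm_n: "2 * (x \<bullet> x) = of_int (\<Sum>i\<in>UNIV. (n x i)^2)" if "x \<in> L" for x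
    unfolding inner[of x x] n[OF that] by (simp add: power2_eq_square)
  \<comment> \<open>An odd square is 1 and an even one 0 modulo 4, so \<open>2 * m\<close> is
    congruent to the weight of \<open>T x\<close>; among the possible weights only 6 is 2 modulo
    4.\<close>
  have card6: "even m \<longleftrightarrow> card (T x) \<noteq> 6" if x: "x \<in> L" "x \<bullet> x = of_int m" for x m
  proof -
    have "real_of_int (2 * m) = of_int (\<Sum>i\<in>UNIV. (n x i)^2)" using norm_n[OF x(1)] x(2) by simp
    then have "2 * m = (\<Sum>i\<in>UNIV. (n x i)^2)" by (simp only: of_int_eq_iff)
    moreover have "4 dvd (\<Sum>i\<in>UNIV. (n x i)^2 - (if i \<in> T x then 1 else 0))"
    proof (rule dvd_sum)
      fix i
      show "4 dvd (n x i)^2 - (if i \<in> T x then 1 else 0)"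
      proof (cases "odd (n x i)")
        case True
        then obtain c where "n x i = 2 * c + 1" by (rule oddE)
        then have "(n x i)^2 - 1 = 4 * (c^2 + c)" by (simp add: power2_eq_square algebra_simps)
        then show ?thesis using True by (simp add: T_def)
      next
        case False
        then obtain c where "n x i = 2 * c" by blast
        then have "(n x i)^2 = 4 * c^2" by (simp add: power2_eq_square)
        then show ?thesis using False by (simp add: T_def)
      qed
    qed
    ultimately have "4 dvd 2 * m - int (card (T x))"
      by (simp add: sum_subtractf sum.If_cases)
    then show ?thesis using weights[OF TC[OF x(1)]] by auto presburger+
  qed
  have T0: "T x0 \<in> C" "card (T x0) = 6" using TC[OF x0(1)] card6[OF x0(1,2)] x0(3) by auto
  \<comment> \<open>The weight 6 word of the odd vector \<open>x0\<close> rules out fixed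
    points.\<close>
  have \<sigma>ne: "\<sigma> i \<noteq> i" for i using \<sigma>[OF T0(1), of i] T0(2) by metis
  have \<sigma>\<sigma>: "\<sigma> (\<sigma> i) = i" for i
  proof (rule ccontr)
    assume "\<sigma> (\<sigma> i) \<noteq> i"
    from sep[OF this] obtain S where S: "S \<in> C" "(\<sigma> (\<sigma> i) \<in> S) \<noteq> (i \<in> S)" by blast
    then show False using \<sigma>[OF S(1), of i] \<sigma>[OF S(1), of "\<sigma> i"] by blast
  qed
  \<comment> \<open>The order on the indices only decides which member of a pair receives the half
    sum and which the half difference.\<close>
  define u where "u i = (if i < \<sigma> i then (1/2) *\<^sub>R (r i + r (\<sigma> i)) else (1/2) *\<^sub>R (r (\<sigma> i) - r i))" for i
  have "u i \<bullet> u j = (if i = j then 1 else 0)" for i j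
  proof -
    consider "j = i" | "j = \<sigma> i" | "j \<noteq> i" "j \<noteq> \<sigma> i" "\<sigma> j \<noteq> i" "\<sigma> j \<noteq> \<sigma> i" using \<sigma>\<sigma> by metis
    then show ?thesis
    proof cases
      case 1
      then show ?thesis using \<sigma>ne[of i] by (auto simp: u_def inner_add_left inner_add_right inner_diff_left inner_diff_right r)
    next
      case 2
      then show ?thesis using \<sigma>ne[of i] \<sigma>\<sigma>[of i]
        by (auto simp: u_def inner_add_left inner_add_right inner_diff_left inner_diff_right r)
    next
      case 3
      then show ?thesis
        by (auto simp: u_def inner_add_left inner_add_right inner_diff_left inner_diff_right r)
    qed
  qed
  moreover have "\<exists>m k :: int. 2 * (x \<bullet> u i) = of_int m \<and> x \<bullet> x = of_int k \<and> (even m \<longleftrightarrow> even k)" if x: "x \<in> L" for x i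
  proof -
    obtain k where k: "x \<bullet> x = of_int k" using self_dual_inner_Ints[OF L x x] by (rule Ints_cases)
    define m where "m = (if i < \<sigma> i then n x i + n x (\<sigma> i) else n x (\<sigma> i) - n x i)"
    have "2 * (x \<bullet> u i) = of_int m"
      using n[OF x] by (simp add: u_def m_def inner_add_right inner_diff_right)
    moreover have "even m \<longleftrightarrow> (i \<in> T x \<longleftrightarrow> \<sigma> i \<in> T x)" by (auto simp: m_def T_def)
    then have "even m \<longleftrightarrow> even k" using \<sigma>[OF TC[OF x], of i] card6[OF x k] by blast
    ultimately show ?thesis using k by blast
  qed
  ultimately show ?thesis by blast
qed

text \<open>The vectors \<open>u i\<close> of \<open>frame_to_orthonormal\<close> lie in the shadow of \<open>L\<close>, so \<open>L\<close> is one of the two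
  lattices \<open>D\<^sub>1\<^sub>2\<^sup>+\<close> attached to the basis \<open>u\<close>; they are exchanged by a sign change of one basis vector.\<close>

lemma odd_coordinates_mem:
  fixes L :: "(real ^ 12) set" and u :: "12 \<Rightarrow> real ^ 12" and a y :: "12 \<Rightarrow> int"
  assumes L: "L = dual_lattice L"
    and u: "\<And>i j. u i \<bullet> u j = (if i = j then 1 else 0)"
    and par: "\<And>x i. x \<in> L \<Longrightarrow> \<exists>m n :: int. 2 * (x \<bullet> u i) = of_int m \<and> x \<bullet> x = of_int n \<and> (even m \<longleftrightarrow> even n)"
    and x0: "x0 \<in> L" "\<And>i. 2 * (x0 \<bullet> u i) = of_int (a i)" "\<And>i. odd (a i)" "4 dvd (\<Sum>i\<in>UNIV. a i)"
    and y: "\<And>i. odd (y i)" "4 dvd (\<Sum>i\<in>UNIV. y i)"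
  shows "(1/2) *\<^sub>R (\<Sum>i\<in>UNIV. of_int (y i) *\<^sub>R u i) \<in> L"
proof (rule self_dual_memI[OF L])
  fix x assume x: "x \<in> L"
  have coords: "\<exists>m n. (\<forall>i. 2 * (x \<bullet> u i) = of_int (m i)) \<and> x \<bullet> x = of_int n \<and> (\<forall>i. even (m i) \<longleftrightarrow> even n)"
    if xL: "x \<in> L" for x
  proof -
    obtain m n where mn: "\<And>i. 2 * (x \<bullet> u i) = of_int (m i) \<and> x \<bullet> x = of_int (n i) \<and> (even (m i) \<longleftrightarrow> even (n i :: int))"
      using par[OF xL] by metis
    have "n i = n j" for i j using mn[of i] mn[of j] by (metis of_int_eq_iff)
    then show ?thesis using mn by metis
  qed
  \<comment> \<open>Such an \<open>x\<close> has integral coordinates \<open>l i\<close> and even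
    norm. The norm is the sum of the \<open>l i ^ 2\<close>, congruent to the sum of the
    \<open>l i\<close> modulo 2, so the doubled coordinates add up to a multiple of 4.\<close>
  have even_sum: "4 dvd (\<Sum>i\<in>UNIV. m i)"
    if xL: "x \<in> L" and xm: "\<And>i. 2 * (x \<bullet> u i) = of_int (m i)" "\<And>i. even (m i)" for x and m :: "12 \<Rightarrow> int"
  proof -
    obtain m' n where m': "\<And>i. 2 * (x \<bullet> u i) = of_int (m' i)" "x \<bullet> x = of_int n" "\<And>i. even (m' i) \<longleftrightarrow> even n"
      using coords[OF xL] by metis
    have "m' i = m i" for i using m'(1)[of i] xm(1)[of i] by (metis of_int_eq_iff)
    then have "even n" using m'(3) xm(2) by metis
    define l where "l i = m i div 2" for i
    have l: "m i = 2 * l i" for i using xm(2)[of i] by (simp add: l_def)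
    have xl: "x \<bullet> u i = of_int (l i)" for i using xm(1)[of i] l[of i] by simp
    have "real_of_int n = of_int (\<Sum>i\<in>UNIV. l i * l i)"
      using orthonormal_family_inner[OF u, of x x] m'(2) by (simp add: xl)
    then have "n = (\<Sum>i\<in>UNIV. l i * l i)" by (simp only: of_int_eq_iff)
    then have "even (\<Sum>i\<in>UNIV. l i)" using \<open>even n\<close> by (simp add: even_sum_iff)
    then have "2 * 2 dvd 2 * (\<Sum>i\<in>UNIV. l i)" by (rule mult_dvd_mono[OF dvd_refl])
    then show ?thesis unfolding l by (simp add: sum_distrib_left)
  qed
  obtain m n where m: "\<And>i. 2 * (x \<bullet> u i) = of_int (m i)" "\<And>i. even (m i) \<longleftrightarrow> even (n :: int)"
    using coords[OF x] by metis
  have "4 dvd (\<Sum>i\<in>UNIV. y i * m i)"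
  proof (cases "even n")
    case True
    then have ev: "even (m i)" for i using m(2) by simp
    have "4 dvd (\<Sum>i\<in>UNIV. (y i - 1) * m i)"
    proof (rule dvd_sum)
      fix i
      have "2 dvd y i - 1" using y(1)[of i] by simp
      then have "2 * 2 dvd (y i - 1) * m i" using ev[of i] by (rule mult_dvd_mono)
      then show "4 dvd (y i - 1) * m i" by simp
    qed
    then have "4 dvd (\<Sum>i\<in>UNIV. (y i - 1) * m i) + (\<Sum>i\<in>UNIV. m i)"
      using even_sum[OF x m(1) ev] by (rule dvd_add)
    then show ?thesis by (simp add: left_diff_distrib sum_subtractf)
  next
    case False
    then have od: "odd (m i)" for i using m(2) by simp
    \<comment> \<open>All coordinates of \<open>x\<close> are half-odd; subtracting the glue vector
      \<open>x0\<close> leads back to integral ones.\<close>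
    have "4 dvd (\<Sum>i\<in>UNIV. m i - a i)"
    proof (rule even_sum)
      show "x - x0 \<in> L" using self_dual_diff[OF L x x0(1)] .
      show "2 * ((x - x0) \<bullet> u i) = of_int (m i - a i)" for i
        using m(1)[of i] x0(2)[of i] by (simp add: inner_diff_left)
      show "even (m i - a i)" for i using od x0(3) by simp
    qed
    then have "4 dvd (\<Sum>i\<in>UNIV. m i - a i) + (\<Sum>i\<in>UNIV. a i)" using x0(4) by (rule dvd_add)
    then have "4 dvd (\<Sum>i\<in>UNIV. m i)" by (simp add: sum_subtractf)
    moreover have "4 dvd (\<Sum>i\<in>UNIV. (y i - 1) * (m i - 1))"
    proof (rule dvd_sum)
      fix i
      have "2 dvd y i - 1" "2 dvd m i - 1" using y(1)[of i] od[of i] by simp_all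
      then have "2 * 2 dvd (y i - 1) * (m i - 1)" by (rule mult_dvd_mono)
      then show "4 dvd (y i - 1) * (m i - 1)" by simp
    qed
    moreover have "(\<Sum>i\<in>UNIV. y i * m i) = (\<Sum>i\<in>UNIV. (y i - 1) * (m i - 1)) + (\<Sum>i\<in>UNIV. y i) + (\<Sum>i\<in>UNIV. m i) - 12"
      by (simp add: algebra_simps sum.distrib sum_subtractf)
    moreover have "(4 :: int) dvd 12" by simp
    ultimately show ?thesis using y(2) by (simp only: dvd_add dvd_diff)
  qed
  then obtain c where c: "(\<Sum>i\<in>UNIV. y i * m i) = 4 * c" by blast
  have "((1/2) *\<^sub>R (\<Sum>i\<in>UNIV. of_int (y i) *\<^sub>R u i)) \<bullet> x = (\<Sum>i\<in>UNIV. of_int (y i) * (x \<bullet> u i)) / 2"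
    by (simp add: inner_sum_left inner_commute[of _ x] inner_sum_right)
  also have "\<dots> = (\<Sum>i\<in>UNIV. of_int (y i) * of_int (m i)) / 4"
    by (simp add: m(1)[symmetric] sum_divide_distrib)
  also have "\<dots> = of_int (\<Sum>i\<in>UNIV. y i * m i) / 4" by simp
  also have "\<dots> = of_int c" unfolding c by simp
  finally show "((1/2) *\<^sub>R (\<Sum>i\<in>UNIV. of_int (y i) *\<^sub>R u i)) \<bullet> x \<in> \<int>" by simp
qed

lemma frame_to_D12_plus:
  fixes L :: "(real ^ 12) set"
  assumes L: "L = dual_lattice L" and min: "\<And>x. x \<in> L \<Longrightarrow> x \<noteq> 0 \<Longrightarrow> 2 \<le> x \<bullet> x"
    and odd: "odd_lattice L" and frame: "contains_frame 2 L"
  shows "\<exists>u :: 12 \<Rightarrow> real ^ 12. (\<forall>i j. u i \<bullet> u j = (if i = j then 1 else 0)) \<and>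
    (\<forall>y :: 12 \<Rightarrow> int. (\<forall>i. odd (y i)) \<longrightarrow> 4 dvd (\<Sum>i\<in>UNIV. y i) \<longrightarrow>
      (1/2) *\<^sub>R (\<Sum>i\<in>UNIV. of_int (y i) *\<^sub>R u i) \<in> L)"
proof -
  obtain r :: "12 \<Rightarrow> real ^ 12" where r: "\<And>i. r i \<in> L" "\<And>i j. r i \<bullet> r j = (if i = j then 2 else 0)"
    using frame unfolding contains_frame_def is_frame_def by (metis of_nat_numeral)
  obtain x0 m0 where x0: "x0 \<in> L" "x0 \<bullet> x0 = of_int m0" "odd m0" using odd unfolding odd_lattice_def by blast
  obtain u :: "12 \<Rightarrow> real ^ 12" where u: "\<forall>i j. u i \<bullet> u j = (if i = j then 1 else 0)"
    and par: "\<forall>x\<in>L. \<forall>i. \<exists>m n :: int. 2 * (x \<bullet> u i) = of_int m \<and> x \<bullet> x = of_int n \<and> (even m \<longleftrightarrow> even n)"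
    using frame_to_orthonormal[OF L min x0 r] by blast
  have "\<exists>a :: int. 2 * (x0 \<bullet> u i) = of_int a \<and> odd a" for i
    using par[rule_format, OF x0(1), of i] x0(2,3) by (metis of_int_eq_iff)
  then obtain a :: "12 \<Rightarrow> int" where a: "\<And>i. 2 * (x0 \<bullet> u i) = of_int (a i)" "\<And>i. odd (a i)" by metis
  show ?thesis
  proof (cases "4 dvd (\<Sum>i\<in>UNIV. a i)")
    case True
    show ?thesis
      using odd_coordinates_mem[OF L u[rule_format] par[rule_format] x0(1) a True] u by blast
  next
    case False
    \<comment> \<open>Twelve odd numbers have an even sum. Negating one basis vector changes the sum
      by \<open>2 * a 0\<close>, which is 2 modulo 4, and so makes it a multiple of 4.\<close>
    define s :: "12 \<Rightarrow> int" where "s i = (if i = 0 then -1 else 1)" for i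
    define v where "v i = of_int (s i) *\<^sub>R u i" for i
    have v: "\<forall>i j. v i \<bullet> v j = (if i = j then 1 else 0)" using u by (auto simp: v_def s_def)
    have parv: "\<exists>m n :: int. 2 * (x \<bullet> v i) = of_int m \<and> x \<bullet> x = of_int n \<and> (even m \<longleftrightarrow> even n)" if xL: "x \<in> L" for x i
    proof -
      obtain m n :: int where "2 * (x \<bullet> u i) = of_int m" "x \<bullet> x = of_int n" "even m \<longleftrightarrow> even n"
        using par[rule_format, OF xL, of i] by blast
      then show ?thesis by (intro exI[of _ "s i * m"] exI[of _ n]) (auto simp: v_def s_def)
    qed
    have av: "2 * (x0 \<bullet> v i) = of_int (s i * a i)" "odd (s i * a i)" for i
      using a[of i] by (auto simp: v_def s_def)
    have "even (\<Sum>i\<in>UNIV. a i)" using a(2) by (simp add: even_sum_iff)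
    moreover have "(\<Sum>i\<in>UNIV. s i * a i) = (\<Sum>i\<in>UNIV. a i) - 2 * a 0"
    proof -
      have "(\<Sum>i\<in>UNIV. s i * a i) = (\<Sum>i\<in>UNIV. a i - (if i = 0 then 2 * a 0 else 0))"
        by (intro sum.cong) (auto simp: s_def)
      then show ?thesis by (simp add: sum_subtractf)
    qed
    ultimately have "4 dvd (\<Sum>i\<in>UNIV. s i * a i)" using False a(2)[of 0] by presburger
    then show ?thesis
      using odd_coordinates_mem[OF L v[rule_format] parv x0(1) av] v by blast
  qed
qed

section \<open>Orthogonal roots\<close>

lemma det_of_int_matrix:
  fixes A :: "real ^ 'n ^ 'n"
  assumes "\<And>i j. A $ i $ j \<in> \<int>"
  shows "det A \<in> \<int>"
  unfolding det_def using assms by (intro Ints_sum Ints_mult Ints_prod) auto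

text \<open>The dual basis, formed by the columns of the inverse of \<open>A\<close>, lies in
  \<open>L\<close> and so is an integral combination \<open>C\<close> of the basis. Thus
  \<open>det A ^ 2 * det C = 1\<close>, where \<open>det A ^ 2\<close> is the integral Gram
  determinant.\<close>

lemma unimodular_lattice_basis:
  fixes L :: "(real ^ 'n) set"
  assumes L: "L = dual_lattice L" and lat: "is_lattice L"
  shows "\<exists>b :: 'n \<Rightarrow> real ^ 'n. L = {\<Sum>i\<in>UNIV. of_int (c i) *\<^sub>R b i | c :: 'n \<Rightarrow> int. True} \<and> \<bar>det (\<chi> i. b i)\<bar> = 1"
proof -
  obtain B where B: "independent B" "span B = UNIV"
    and LB: "L = {\<Sum>b\<in>B. of_int (c b) *\<^sub>R b | c :: real ^ 'n \<Rightarrow> int. True}"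
    using lat unfolding is_lattice_def by blast
  have "finite B" using B(1) by (rule independent_imp_finite)
  moreover have "card B = CARD('n)"
    using B dim_eq_card[of B UNIV] by (simp add: dim_UNIV)
  ultimately obtain b :: "'n \<Rightarrow> real ^ 'n" where b: "bij_betw b UNIV B"
    using finite_same_card_bij[of "UNIV :: 'n set" B] by auto
  have Lb: "L = {\<Sum>i\<in>UNIV. of_int (c i) *\<^sub>R b i | c :: 'n \<Rightarrow> int. True}"
  proof -
    have "(\<Sum>x\<in>B. of_int (c x) *\<^sub>R x) = (\<Sum>i\<in>UNIV. of_int (c (b i)) *\<^sub>R b i)" for c :: "real ^ 'n \<Rightarrow> int"
      by (rule sum.reindex_bij_betw[OF b, symmetric])
    moreover have "(\<Sum>i\<in>UNIV. of_int (c i) *\<^sub>R b i) = (\<Sum>x\<in>B. of_int (c (inv b x)) *\<^sub>R x)" for c :: "'n \<Rightarrow> int"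
    proof -
      have "inv b (b i) = i" for i using b by (simp add: bij_betw_def)
      then show ?thesis using sum.reindex_bij_betw[OF b, of "\<lambda>x. of_int (c (inv b x)) *\<^sub>R x"] by simp
    qed
    ultimately show ?thesis unfolding LB by (auto, metis)
  qed
  define A :: "real ^ 'n ^ 'n" where "A = (\<chi> i. b i)"
  have "rows A = B" using b by (auto simp: rows_def row_def A_def bij_betw_def vec_lambda_eta)
  then obtain M where M: "M ** A = mat 1"
    using matrix_left_invertible_span_rows[of A] B(2) by auto
  then have AM: "A ** M = mat 1" by (metis matrix_left_right_inverse)
  have bL: "b i \<in> L" for i
  proof -
    have "b i = (\<Sum>j\<in>UNIV. of_int (if j = i then 1 else 0) *\<^sub>R b j)"
      by (simp add: if_distrib[of "\<lambda>x. x *\<^sub>R _"] if_distrib[of of_int] cong: if_cong)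
    then show ?thesis unfolding Lb by (intro CollectI exI[of _ "\<lambda>j. if j = i then 1 else 0"]) simp
  qed
  have inner: "b i \<bullet> column j M = (if i = j then 1 else 0)" for i j
  proof -
    have "b i \<bullet> column j M = (A ** M) $ i $ j"
      by (simp add: matrix_matrix_mult_def A_def inner_vec_def column_def)
    then show ?thesis by (simp add: AM mat_def)
  qed
  have "column j M \<in> L" for j
  proof (rule self_dual_memI[OF L])
    fix y assume "y \<in> L"
    then obtain c :: "'n \<Rightarrow> int" where "y = (\<Sum>i\<in>UNIV. of_int (c i) *\<^sub>R b i)" unfolding Lb by blast
    then show "column j M \<bullet> y \<in> \<int>"
      by (auto simp: inner_sum_right inner_commute[of "column j M"] inner intro!: Ints_sum)
  qed
  then have "\<exists>c :: 'n \<Rightarrow> int. column j M = (\<Sum>i\<in>UNIV. of_int (c i) *\<^sub>R b i)" for j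
    unfolding Lb by blast
  then obtain c :: "'n \<Rightarrow> 'n \<Rightarrow> int" where c: "\<And>j. column j M = (\<Sum>i\<in>UNIV. of_int (c j i) *\<^sub>R b i)" by metis
  define C :: "real ^ 'n ^ 'n" where "C = (\<chi> j i. of_int (c j i))"
  have "transpose M = C ** A"
  proof -
    have "transpose M $ j $ k = (C ** A) $ j $ k" for j k
      using arg_cong[OF c[of j], of "\<lambda>v. v $ k"]
      by (simp add: transpose_def column_def C_def A_def matrix_matrix_mult_def)
    then show ?thesis by (simp add: vec_eq_iff)
  qed
  then have "det M = det C * det A" by (metis det_mul det_transpose)
  then have 1: "det A * det A * det C = 1"
    using arg_cong[OF AM, of det] by (simp add: det_mul mult_ac)
  have "det C \<in> \<int>" by (rule det_of_int_matrix) (simp add: C_def)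
  moreover have "det (A ** transpose A) \<in> \<int>"
  proof (rule det_of_int_matrix)
    fix i j
    have "(A ** transpose A) $ i $ j = b i \<bullet> b j"
      by (simp add: matrix_matrix_mult_def transpose_def A_def inner_vec_def)
    then show "(A ** transpose A) $ i $ j \<in> \<int>" using self_dual_inner_Ints[OF L bL bL] by simp
  qed
  ultimately obtain p q :: int where pq: "det C = of_int p" "det A * det A = of_int q"
    by (auto simp: det_mul det_transpose elim!: Ints_cases)
  have "real_of_int (q * p) = of_int 1" using 1 pq by simp
  then have "q * p = 1" by (simp only: of_int_eq_iff)
  moreover have "q \<ge> 0" using pq(2) zero_le_square[of "det A"] by (simp only: of_int_0_le_iff)
  ultimately have "q = 1" using zmult_eq_1_iff[of q p] by auto
  then have "\<bar>det A\<bar> = 1" using pq(2) by (metis abs_1 abs_mult_self_eq of_int_1 real_sqrt_abs2 real_sqrt_one)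
  then show ?thesis using Lb unfolding A_def by blast
qed

text \<open>Blichfeldt's inequality: points at distance at least 2 have total weight at most 2, where a
  point at distance \<open>r < \<surd>2\<close> from the origin has weight \<open>2 - r\<^sup>2\<close>.\<close>

lemma sum_ball_weights_le:
  fixes q :: "'b \<Rightarrow> 'a \<Rightarrow> real"
  assumes P: "finite P" and K: "finite K"
    and sep: "\<And>p p'. p \<in> P \<Longrightarrow> p' \<in> P \<Longrightarrow> p \<noteq> p' \<Longrightarrow> 4 \<le> (\<Sum>i\<in>K. (q p i - q p' i)^2)"
  shows "(\<Sum>p\<in>P. 2 - (\<Sum>i\<in>K. (q p i)^2)) \<le> 2"
proof (cases "P = {}")
  case False
  define m where "m = real (card P)"
  have m: "m \<ge> 1" using False P by (simp add: m_def Suc_le_eq card_gt_0_iff)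
  define Q where "Q = (\<Sum>p\<in>P. \<Sum>i\<in>K. (q p i)^2)"
  \<comment> \<open>The sum of squared differences is \<open>2 m\<close> times the sum of squares
    minus twice the square of the sum; the latter is dropped. Against separation 4 for the
    \<open>m (m - 1)\<close> ordered pairs this gives \<open>2 (m - 1) <= Q\<close>.\<close>
  have "(\<Sum>p\<in>P. \<Sum>p'\<in>P. (q p i - q p' i)^2) \<le> 2 * m * (\<Sum>p\<in>P. (q p i)^2)" for i
  proof -
    have "(\<Sum>p\<in>P. \<Sum>p'\<in>P. (q p i - q p' i)^2)
      = (\<Sum>p\<in>P. \<Sum>p'\<in>P. (q p i)^2 + (q p' i)^2 - 2 * (q p i * q p' i))"
      by (simp add: power2_diff mult_ac)
    also have "\<dots> = 2 * m * (\<Sum>p\<in>P. (q p i)^2) - 2 * ((\<Sum>p\<in>P. q p i) * (\<Sum>p\<in>P. q p i))"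
      by (simp add: sum_subtractf sum.distrib sum_product sum_distrib_left m_def mult_ac)
    also have "\<dots> \<le> 2 * m * (\<Sum>p\<in>P. (q p i)^2)" by simp
    finally show ?thesis .
  qed
  then have "(\<Sum>i\<in>K. \<Sum>p\<in>P. \<Sum>p'\<in>P. (q p i - q p' i)^2) \<le> (\<Sum>i\<in>K. 2 * m * (\<Sum>p\<in>P. (q p i)^2))"
    by (rule sum_mono)
  also have "\<dots> = 2 * m * Q"
    unfolding Q_def sum.swap[of _ K P] by (simp add: sum_distrib_left)
  also have "(\<Sum>i\<in>K. \<Sum>p\<in>P. \<Sum>p'\<in>P. (q p i - q p' i)^2) = (\<Sum>p\<in>P. \<Sum>p'\<in>P. \<Sum>i\<in>K. (q p i - q p' i)^2)"
    by (subst sum.swap) (intro sum.cong refl sum.swap)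
  finally have up: "(\<Sum>p\<in>P. \<Sum>p'\<in>P. \<Sum>i\<in>K. (q p i - q p' i)^2) \<le> 2 * m * Q" .
  have "(\<Sum>p'\<in>P. if p' = p then 0 else 4) \<le> (\<Sum>p'\<in>P. \<Sum>i\<in>K. (q p i - q p' i)^2)" if "p \<in> P" for p
    using sep that by (intro sum_mono) (auto intro: sum_nonneg)
  moreover have "(\<Sum>p'\<in>P. if p' = p then 0 else 4) = 4 * (m - 1)" if "p \<in> P" for p
  proof -
    have "(\<Sum>p'\<in>P. if p' = p then 0 else (4::real)) = (\<Sum>p'\<in>P. 4 - (if p' = p then 4 else 0))"
      by (intro sum.cong) auto
    then show ?thesis using that P by (simp add: sum_subtractf m_def)
  qed
  ultimately have "(\<Sum>p\<in>P. 4 * (m - 1)) \<le> (\<Sum>p\<in>P. \<Sum>p'\<in>P. \<Sum>i\<in>K. (q p i - q p' i)^2)"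
    by (intro sum_mono) auto
  then have "m * (4 * (m - 1)) \<le> m * (2 * Q)" using up by (simp add: m_def mult_ac)
  then have "4 * (m - 1) \<le> 2 * Q" using m by simp
  moreover have *: "(\<Sum>p\<in>P. 2 - (\<Sum>i\<in>K. (q p i)^2)) = 2 * m - Q"
    by (simp add: sum_subtractf m_def Q_def)
  ultimately show ?thesis unfolding * by simp
qed simp

section \<open>Parity classes relative to a set of roots\<close>

lemma Ints_half_diff:
  fixes a b :: real
  assumes "a \<in> \<int>" "b \<in> \<int>" "a / 2 \<in> \<int> \<longleftrightarrow> b / 2 \<in> \<int>"
  shows "(a - b) / 2 \<in> \<int>"
proof -
  have half: "real_of_int c / 2 \<in> \<int> \<longleftrightarrow> even c" for c
  proof
    assume "real_of_int c / 2 \<in> \<int>"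
    then obtain d where "real_of_int c / 2 = of_int d" by (rule Ints_cases)
    then have "real_of_int c = of_int (2 * d)" by simp
    then have "c = 2 * d" by (simp only: of_int_eq_iff)
    then show "even c" by simp
  qed auto
  obtain c d where "a = of_int c" "b = of_int d" using assms(1,2) by (auto elim!: Ints_cases)
  then show ?thesis using assms(3) half[of c] half[of d] half[of "c - d"] by simp
qed

text \<open>Labels the cosets in \<open>L\<close> of the sublattice of vectors of even norm that are
  even against \<open>R\<close>: norm parity is additive on an integral lattice. The number of
  signatures is the index of this sublattice.\<close>

definition parity_signature :: "(real ^ 'n) set \<Rightarrow> real ^ 'n \<Rightarrow> bool \<times> (real ^ 'n) set" where
  "parity_signature R x = (x \<bullet> x / 2 \<in> \<int>, {r\<in>R. x \<bullet> r / 2 \<in> \<int>})"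

lemma Ints_add_iff: "(b::real) \<in> \<int> \<Longrightarrow> a + b \<in> \<int> \<longleftrightarrow> a \<in> \<int>"
  by (metis Ints_add Ints_diff add_diff_cancel_right')

lemma parity_signature_add:
  assumes "x \<bullet> k \<in> \<int>" "k \<bullet> k / 2 \<in> \<int>" "\<And>r. r \<in> R \<Longrightarrow> k \<bullet> r / 2 \<in> \<int>"
  shows "parity_signature R (x + k) = parity_signature R x"
proof -
  have "(x + k) \<bullet> (x + k) / 2 = x \<bullet> x / 2 + (x \<bullet> k + k \<bullet> k / 2)"
    by (simp add: inner_add_left inner_add_right inner_commute[of k x])
  then have "(x + k) \<bullet> (x + k) / 2 \<in> \<int> \<longleftrightarrow> x \<bullet> x / 2 \<in> \<int>"
    using assms(1,2) by (simp only: Ints_add_iff Ints_add)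
  moreover have "(x + k) \<bullet> r / 2 \<in> \<int> \<longleftrightarrow> x \<bullet> r / 2 \<in> \<int>" if "r \<in> R" for r
    using Ints_add_iff[OF assms(3)[OF that], of "x \<bullet> r / 2"] by (simp add: inner_add_left add_divide_distrib)
  ultimately show ?thesis
    unfolding parity_signature_def by auto
qed

lemma parity_signature_diff:
  assumes L: "L = dual_lattice L" and R: "R \<subseteq> L" and xy: "x \<in> L" "y \<in> L"
    and eq: "parity_signature R x = parity_signature R y"
  shows "(x - y) \<bullet> (x - y) / 2 \<in> \<int>" "r \<in> R \<Longrightarrow> (x - y) \<bullet> r / 2 \<in> \<int>"
proof -
  have "(x \<bullet> x - y \<bullet> y) / 2 \<in> \<int>"
    using eq xy by (intro Ints_half_diff self_dual_inner_Ints[OF L]) (auto simp: parity_signature_def)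
  moreover have "y \<bullet> y - x \<bullet> y \<in> \<int>"
    using self_dual_inner_Ints[OF L] xy by (intro Ints_diff) auto
  moreover have "(x - y) \<bullet> (x - y) / 2 = (x \<bullet> x - y \<bullet> y) / 2 + (y \<bullet> y - x \<bullet> y)"
    by (simp add: inner_diff_left inner_diff_right inner_commute[of y x] field_simps)
  ultimately show "(x - y) \<bullet> (x - y) / 2 \<in> \<int>" by (simp only: Ints_add)
  assume r: "r \<in> R"
  then have "x \<bullet> r / 2 \<in> \<int> \<longleftrightarrow> y \<bullet> r / 2 \<in> \<int>"
    using eq by (auto simp: parity_signature_def)
  then show "(x - y) \<bullet> r / 2 \<in> \<int>"
    using Ints_half_diff[of "x \<bullet> r" "y \<bullet> r"] self_dual_inner_Ints[OF L] xy r R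
    by (auto simp: inner_diff_left)
qed

lemma card_parity_signatures_le_power:
  assumes "finite R"
  shows "finite (parity_signature R ` L)" "card (parity_signature R ` L) \<le> 2 * 2 ^ card R"
proof -
  have sub: "parity_signature R ` L \<subseteq> UNIV \<times> Pow R"
    by (auto simp: parity_signature_def)
  have fin: "finite ((UNIV :: bool set) \<times> Pow R)" using assms by simp
  show "finite (parity_signature R ` L)" using finite_subset[OF sub fin] .
  show "card (parity_signature R ` L) \<le> 2 * 2 ^ card R"
    using card_mono[OF fin sub] assms by (simp add: card_cartesian_product card_Pow)
qed

text \<open>The roots span a totally isotropic subspace of \<open>L/2L\<close>, whose dimension is thus at most 6.\<close>

lemma card_parity_signatures_le_64:
  fixes L :: "(real ^ 12) set"
  assumes L: "L = dual_lattice L" and lat: "is_lattice L"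
    and R: "finite R" "R \<subseteq> L" and rr: "\<And>r. r \<in> R \<Longrightarrow> r \<bullet> r = 2"
    and orth: "\<And>r s. r \<in> R \<Longrightarrow> s \<in> R \<Longrightarrow> r \<noteq> s \<Longrightarrow> r \<bullet> s = 0"
  shows "card (parity_signature R ` L) \<le> 64"
proof -
  obtain b :: "12 \<Rightarrow> real ^ 12" where Lb: "L = {\<Sum>i\<in>UNIV. of_int (c i) *\<^sub>R b i | c :: 12 \<Rightarrow> int. True}"
    using unimodular_lattice_basis[OF L lat] by blast
  define ev where "ev x r \<longleftrightarrow> x \<bullet> r / 2 \<in> \<int>" for x r :: "real ^ 12"
  \<comment> \<open>A smallest good \<open>T\<close> plays the role of a basis for the span of
    \<open>R\<close> in \<open>L/2L\<close>.\<close>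
  define good where "good T \<longleftrightarrow> T \<subseteq> R \<and> (\<forall>x\<in>L. (\<forall>r\<in>T. ev x r) \<longrightarrow> (\<forall>r\<in>R. ev x r))" for T
  have "good R" by (simp add: good_def)
  then obtain T where T: "good T" and Tmin: "\<And>T'. good T' \<Longrightarrow> card T \<le> card T'"
    using ex_has_least_nat[of good R card] by blast
  have TR: "T \<subseteq> R" using T by (simp add: good_def)
  have finT: "finite T" using finite_subset[OF TR R(1)] .
  define c where "c = card (parity_signature R ` L)"
  define m where "m = card T"
  have finS: "finite (parity_signature R ` L)" using card_parity_signatures_le_power[OF R(1)] by blast
  \<comment> \<open>Evenness against \<open>T\<close> decides evenness against all of
    \<open>R\<close>, so there are at most \<open>2 * 2 ^ m\<close> signatures.\<close>
  have "inj_on (\<lambda>(e, S). (e, S \<inter> T)) (parity_signature R ` L)"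
  proof (rule inj_onI, clarsimp simp: parity_signature_def)
    fix x y assume xy: "x \<in> L" "y \<in> L" and eq: "{r\<in>R. x \<bullet> r / 2 \<in> \<int>} \<inter> T = {r\<in>R. y \<bullet> r / 2 \<in> \<int>} \<inter> T"
    have "ev (x - y) r" if r: "r \<in> T" for r
    proof -
      have "x \<bullet> r / 2 \<in> \<int> \<longleftrightarrow> y \<bullet> r / 2 \<in> \<int>" using eq r TR by blast
      then show ?thesis
        using Ints_half_diff[of "x \<bullet> r" "y \<bullet> r"] self_dual_inner_Ints[OF L] xy r R TR
        by (auto simp: ev_def inner_diff_left)
    qed
    then have e: "ev (x - y) r" if "r \<in> R" for r
      using T self_dual_diff[OF L xy] that unfolding good_def by blast
    have "x \<bullet> r / 2 \<in> \<int> \<longleftrightarrow> y \<bullet> r / 2 \<in> \<int>" if "r \<in> R" for r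
      using Ints_add_iff[OF e[OF that, unfolded ev_def], of "y \<bullet> r / 2"]
      by (simp add: inner_diff_left diff_divide_distrib)
    then show "{r\<in>R. x \<bullet> r / 2 \<in> \<int>} = {r\<in>R. y \<bullet> r / 2 \<in> \<int>}" by blast
  qed
  moreover have "(\<lambda>(e, S). (e, S \<inter> T)) ` (parity_signature R ` L) \<subseteq> UNIV \<times> Pow T" by auto
  ultimately have "c \<le> card ((UNIV :: bool set) \<times> Pow T)"
    unfolding c_def using finT by (intro card_inj_on_le) auto
  then have c1: "c \<le> 2 * 2 ^ m"
    using finT by (simp add: card_cartesian_product card_Pow m_def)
  have "\<forall>x\<in>L. \<exists>k :: 12 \<Rightarrow> int. x = (\<Sum>i\<in>UNIV. of_int (k i) *\<^sub>R b i)"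
    unfolding Lb by blast
  from bchoice[OF this] obtain co :: "real ^ 12 \<Rightarrow> 12 \<Rightarrow> int"
    where co: "\<And>x. x \<in> L \<Longrightarrow> x = (\<Sum>i\<in>UNIV. of_int (co x i) *\<^sub>R b i)" by blast
  define par where "par x = {i. odd (co x i)}" for x
  have par_eq: "\<exists>y\<in>L. x - x' = 2 *\<^sub>R y" if x: "x \<in> L" "x' \<in> L" and eq: "par x = par x'" for x x'
  proof -
    have ev: "even (co x i - co x' i)" for i using eq by (auto simp: par_def)
    define k where "k i = (co x i - co x' i) div 2" for i
    have k: "co x i - co x' i = 2 * k i" for i using ev[of i] by (simp add: k_def)
    have "x - x' = (\<Sum>i\<in>UNIV. of_int (co x i - co x' i) *\<^sub>R b i)"
      by (subst co[OF x(1)], subst co[OF x(2)]) (simp add: sum_subtractf scaleR_diff_left)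
    also have "\<dots> = 2 *\<^sub>R (\<Sum>i\<in>UNIV. of_int (k i) *\<^sub>R b i)"
      by (simp add: k scaleR_sum_right)
    finally show ?thesis unfolding Lb by blast
  qed
  define xs where "xs \<sigma> = (SOME x. x \<in> L \<and> parity_signature R x = \<sigma>)" for \<sigma>
  have xs: "xs \<sigma> \<in> L" "parity_signature R (xs \<sigma>) = \<sigma>" if "\<sigma> \<in> parity_signature R ` L" for \<sigma>
    using someI_ex[of "\<lambda>x. x \<in> L \<and> parity_signature R x = \<sigma>"] that unfolding xs_def by blast+
  have SL: "\<Sum>S \<in> L" if "S \<subseteq> T" for S using that TR R(2) by (intro self_dual_sum[OF L]) auto
  have Sr: "(\<Sum>S) \<bullet> r = (if r \<in> S then 2 else 0)" if "S \<subseteq> T" "r \<in> R" for S r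
  proof -
    have "(\<Sum>S) \<bullet> r = (\<Sum>s\<in>S. if s = r then 2 else 0)"
      unfolding inner_sum_left using that TR rr orth by (intro sum.cong) auto
    then show ?thesis using finite_subset[OF that(1) finT] by simp
  qed
  have Sev: "(\<Sum>S) \<bullet> (\<Sum>S) / 2 \<in> \<int>" if "S \<subseteq> T" for S
  proof -
    have "(\<Sum>S) \<bullet> (\<Sum>S) = (\<Sum>r\<in>S. 2)"
      unfolding inner_sum_right[of "\<Sum>S"] using Sr[OF that] that TR by (intro sum.cong) auto
    then show ?thesis by simp
  qed
  have sig_add: "parity_signature R (x + \<Sum>S) = parity_signature R x" if "x \<in> L" "S \<subseteq> T" for x S
    using that self_dual_inner_Ints[OF L that(1) SL[OF that(2)]] Sev[OF that(2)] Sr[OF that(2)]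
    by (intro parity_signature_add) auto
  \<comment> \<open>\<open>par\<close> is the class in \<open>L/2L\<close>. Adding roots from
    \<open>T\<close> keeps the signature, so each signature accounts for \<open>2 ^ m\<close> of the
    \<open>2 ^ 12\<close> classes.\<close>
  have "inj_on (\<lambda>(\<sigma>, S). par (xs \<sigma> + \<Sum>S)) ((parity_signature R ` L) \<times> Pow T)"
  proof (rule inj_onI)
    fix p p' assume p: "p \<in> (parity_signature R ` L) \<times> Pow T" "p' \<in> (parity_signature R ` L) \<times> Pow T"
      and "(\<lambda>(\<sigma>, S). par (xs \<sigma> + \<Sum>S)) p = (\<lambda>(\<sigma>, S). par (xs \<sigma> + \<Sum>S)) p'"
    moreover obtain \<sigma> S \<sigma>' S' where pp: "p = (\<sigma>, S)" "p' = (\<sigma>', S')" by fastforce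
    ultimately have \<sigma>: "\<sigma> \<in> parity_signature R ` L" "\<sigma>' \<in> parity_signature R ` L" and S: "S \<subseteq> T" "S' \<subseteq> T"
      and eq: "par (xs \<sigma> + \<Sum>S) = par (xs \<sigma>' + \<Sum>S')" by auto
    have mem: "xs \<sigma> + \<Sum>S \<in> L" "xs \<sigma>' + \<Sum>S' \<in> L"
      by (rule self_dual_add[OF L xs(1)[OF \<sigma>(1)] SL[OF S(1)]], rule self_dual_add[OF L xs(1)[OF \<sigma>(2)] SL[OF S(2)]])
    obtain y where y: "y \<in> L" "(xs \<sigma> + \<Sum>S) - (xs \<sigma>' + \<Sum>S') = 2 *\<^sub>R y" using par_eq[OF mem eq] by blast
    have "\<sigma> = parity_signature R (xs \<sigma> + \<Sum>S)" using sig_add xs \<sigma> S by simp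
    also have "xs \<sigma> + \<Sum>S = (xs \<sigma>' + \<Sum>S') + 2 *\<^sub>R y" using y(2) by (simp add: algebra_simps)
    also have "parity_signature R \<dots> = parity_signature R (xs \<sigma>' + \<Sum>S')"
    proof (rule parity_signature_add)
      show "(xs \<sigma>' + \<Sum>S') \<bullet> (2 *\<^sub>R y) \<in> \<int>"
        using self_dual_inner_Ints[OF L mem(2) y(1)] by (auto intro: Ints_mult)
      show "(2 *\<^sub>R y) \<bullet> (2 *\<^sub>R y) / 2 \<in> \<int>"
        using self_dual_inner_Ints[OF L y(1) y(1)] by (auto intro: Ints_mult)
      show "(2 *\<^sub>R y) \<bullet> r / 2 \<in> \<int>" if "r \<in> R" for r
        using self_dual_inner_Ints[OF L y(1)] that R(2) by auto
    qed
    also have "\<dots> = \<sigma>'" using sig_add xs \<sigma> S by simp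
    finally have ss: "\<sigma> = \<sigma>'" .
    have "S = S'"
    proof (rule ccontr)
      assume "S \<noteq> S'"
      then obtain t where t: "t \<in> T" "(t \<in> S) \<noteq> (t \<in> S')" using S by blast
      \<comment> \<open>Two subset sums congruent modulo \<open>2L\<close> express \<open>t\<close>
        through the other members of \<open>T\<close>, so evenness against those forces evenness
        against \<open>t\<close>, contrary to minimality.\<close>
      have "good (T - {t})"
        unfolding good_def
      proof (intro conjI ballI impI)
        show "T - {t} \<subseteq> R" using TR by blast
        fix x r assume x: "x \<in> L" "\<forall>r\<in>T - {t}. ev x r" and r: "r \<in> R"
        have part: "(\<Sum>S'') \<bullet> x / 2 \<in> \<int> \<longleftrightarrow> (t \<in> S'' \<longrightarrow> ev x t)" if "S'' \<subseteq> T" for S''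
        proof -
          have "(\<Sum>(S'' - {t})) \<bullet> x / 2 = (\<Sum>r\<in>S'' - {t}. x \<bullet> r / 2)"
            by (simp add: inner_sum_left sum_divide_distrib inner_commute[of x])
          also have "\<dots> \<in> \<int>" using x(2) that by (intro Ints_sum) (auto simp: ev_def)
          finally have *: "(\<Sum>(S'' - {t})) \<bullet> x / 2 \<in> \<int>" .
          show ?thesis
          proof (cases "t \<in> S''")
            case True
            have "\<Sum>S'' = t + \<Sum>(S'' - {t})"
              using finite_subset[OF that finT] True by (simp add: sum.remove)
            then have "(\<Sum>S'') \<bullet> x / 2 = x \<bullet> t / 2 + (\<Sum>(S'' - {t})) \<bullet> x / 2"
              by (simp add: inner_add_left inner_commute[of x t] add_divide_distrib)
            then show ?thesis using Ints_add_iff[OF *, of "x \<bullet> t / 2"] True by (simp add: ev_def add_divide_distrib)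
          qed (use * in simp)
        qed
        have "(\<Sum>S) \<bullet> x / 2 - (\<Sum>S') \<bullet> x / 2 = y \<bullet> x"
          using arg_cong[OF y(2), of "\<lambda>v. v \<bullet> x / 2"] ss by (simp add: inner_diff_left diff_divide_distrib)
        moreover have "y \<bullet> x \<in> \<int>" using self_dual_inner_Ints[OF L y(1) x(1)] .
        ultimately have "(\<Sum>S) \<bullet> x / 2 \<in> \<int> \<longleftrightarrow> (\<Sum>S') \<bullet> x / 2 \<in> \<int>"
          using Ints_add_iff[of "y \<bullet> x" "(\<Sum>S') \<bullet> x / 2"] by (simp add: add_divide_distrib algebra_simps)
        then have "ev x t" using part[OF S(1)] part[OF S(2)] t(2) by blast
        then show "ev x r" using T x r unfolding good_def by (metis DiffI singletonD)
      qed
      then have "card T \<le> card (T - {t})" by (rule Tmin)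
      then show False using t(1) finT by (metis card_Diff1_less not_le)
    qed
    then show "p = p'" using ss pp by simp
  qed
  then have "card ((parity_signature R ` L) \<times> Pow T) \<le> card (UNIV :: 12 set set)"
    by (rule card_inj_on_le) auto
  then have c2: "c * 2 ^ m \<le> 4096"
    using finT by (simp add: card_cartesian_product card_Pow c_def m_def card_UNIV_set)
  show ?thesis
  \<comment> \<open>The bounds \<open>c <= 2 * 2 ^ m\<close> and \<open>c * 2 ^ m <= 4096\<close>
    give 64 on the two sides of this split.\<close>
  proof (cases "m \<le> 5")
    case True
    then have "(2::nat) ^ m \<le> 2 ^ 5" by (rule power_increasing) simp
    then show ?thesis using c1 by (simp add: c_def)
  next
    case False
    then have "(2::nat) ^ 6 \<le> 2 ^ m" by (intro power_increasing) auto
    then have "c * 64 \<le> c * 2 ^ m" by (intro mult_le_mono2) simp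
    then have "c \<le> 64" using c2 by linarith
    then show ?thesis by (simp add: c_def)
  qed
qed

section \<open>The integral of the Blichfeldt weight over a box times a ball\<close>

definition ball_weight :: "'a set \<Rightarrow> ('a \<Rightarrow> real) \<Rightarrow> real" where
  "ball_weight A y = max 0 (2 - (\<Sum>i\<in>A. (y i)^2))"

text \<open>The weight is, up to the factor \<open>\<pi>\<close>, the area of the section of a ball with two more
  dimensions, so no one-dimensional integral has to be computed.\<close>

lemma nn_integral_ball_weight:
  fixes A :: "'a set"
  assumes A: "finite A" and pq: "p \<noteq> q" "p \<notin> A" "q \<notin> A"
  shows "ennreal (unit_ball_vol (real (card A + 2)) * sqrt 2 ^ (card A + 2)) \<le>
    (\<integral>\<^sup>+y. ennreal (pi * ball_weight A y) \<partial>(\<Pi>\<^sub>M i\<in>A. lborel))"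
proof -
  interpret product_sigma_finite "\<lambda>_::'a. lborel :: real measure" by standard
  define B where "B = {p, q}"
  have B: "finite B" "A \<inter> B = {}" "card B = 2" using pq by (auto simp: B_def)
  define S where "S = {f. sqrt (\<Sum>i\<in>A \<union> B. (f i)\<^sup>2) \<le> sqrt 2} \<inter> space (\<Pi>\<^sub>M i\<in>A \<union> B. lborel :: real measure)"
  have Sm: "S \<in> sets (\<Pi>\<^sub>M i\<in>A \<union> B. lborel)"
    unfolding S_def using A B by measurable
  have cAB: "card (A \<union> B) = card A + 2" using A B by (simp add: card_Un_disjoint)
  have "ennreal (unit_ball_vol (real (card A + 2)) * sqrt 2 ^ (card A + 2)) = emeasure (\<Pi>\<^sub>M i\<in>A \<union> B. lborel) S"
    unfolding S_def using emeasure_cball_aux[of "A \<union> B" "sqrt 2"] A B cAB by simp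
  also have "\<dots> = (\<integral>\<^sup>+f. indicator S f \<partial>(\<Pi>\<^sub>M i\<in>A \<union> B. lborel))"
    using Sm by simp
  also have "\<dots> = (\<integral>\<^sup>+y. (\<integral>\<^sup>+z. indicator S (merge A B (y, z)) \<partial>(\<Pi>\<^sub>M i\<in>B. lborel)) \<partial>(\<Pi>\<^sub>M i\<in>A. lborel))"
    using Sm A B by (intro product_nn_integral_fold) auto
  also have "\<dots> \<le> (\<integral>\<^sup>+y. ennreal (pi * ball_weight A y) \<partial>(\<Pi>\<^sub>M i\<in>A. lborel))"
  proof (rule nn_integral_mono)
    fix y assume y: "y \<in> space (\<Pi>\<^sub>M i\<in>A. lborel :: real measure)"
    define s where "s = (\<Sum>i\<in>A. (y i)^2)"
    define D where "D r = {z. sqrt (\<Sum>i\<in>B. (z i)\<^sup>2) \<le> r} \<inter> space (\<Pi>\<^sub>M i\<in>B. lborel :: real measure)" for r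
    have Dm: "D r \<in> sets (\<Pi>\<^sub>M i\<in>B. lborel)" for r
      unfolding D_def using B by measurable
    have mem: "merge A B (y, z) \<in> S \<longleftrightarrow> s + (\<Sum>i\<in>B. (z i)^2) \<le> 2" if "z \<in> space (\<Pi>\<^sub>M i\<in>B. lborel :: real measure)" for z
    proof -
      have "(\<Sum>i\<in>A \<union> B. (merge A B (y, z) i)\<^sup>2) = s + (\<Sum>i\<in>B. (z i)^2)"
      proof -
        have "(\<Sum>i\<in>A. (merge A B (y, z) i)\<^sup>2) = s"
          unfolding s_def by (intro sum.cong) (auto simp: merge_def)
        moreover have "(\<Sum>i\<in>B. (merge A B (y, z) i)\<^sup>2) = (\<Sum>i\<in>B. (z i)^2)"
          using B(2) by (intro sum.cong) (auto simp: merge_def)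
        ultimately show ?thesis using A B by (simp add: sum.union_disjoint)
      qed
      moreover have "merge A B (y, z) \<in> space (\<Pi>\<^sub>M i\<in>A \<union> B. lborel :: real measure)"
        using y that B(2) by (auto simp: space_PiM PiE_def extensional_def merge_def)
      ultimately show ?thesis unfolding S_def by simp
    qed
    have int: "(\<integral>\<^sup>+z. indicator S (merge A B (y, z)) \<partial>(\<Pi>\<^sub>M i\<in>B. lborel)) \<le> ennreal (pi * r^2)"
      if r: "r > 0" "2 - s \<le> r^2" for r
    proof -
      have "(\<integral>\<^sup>+z. indicator S (merge A B (y, z)) \<partial>(\<Pi>\<^sub>M i\<in>B. lborel)) \<le> (\<integral>\<^sup>+z. indicator (D r) z \<partial>(\<Pi>\<^sub>M i\<in>B. lborel))"
      proof (rule nn_integral_mono)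
        fix z assume z: "z \<in> space (\<Pi>\<^sub>M i\<in>B. lborel :: real measure)"
        have "z \<in> D r" if "merge A B (y, z) \<in> S"
        proof -
          have "(\<Sum>i\<in>B. (z i)^2) \<le> r^2" using mem[OF z] that r(2) by linarith
          then have "sqrt (\<Sum>i\<in>B. (z i)^2) \<le> r" using r(1) by (simp add: real_le_lsqrt sum_nonneg)
          then show ?thesis using z by (simp add: D_def)
        qed
        then show "indicator S (merge A B (y, z)) \<le> (indicator (D r) z :: ennreal)"
          by (auto simp: indicator_def)
      qed
      also have "\<dots> = emeasure (\<Pi>\<^sub>M i\<in>B. lborel) (D r)" using Dm by simp
      also have "\<dots> = ennreal (pi * r^2)"
        unfolding D_def using emeasure_cball_aux[of B r] B r(1) by (simp add: unit_ball_vol_2)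
      finally show ?thesis .
    qed
    show "(\<integral>\<^sup>+z. indicator S (merge A B (y, z)) \<partial>(\<Pi>\<^sub>M i\<in>B. lborel)) \<le> ennreal (pi * ball_weight A y)"
    proof (cases "s < 2")
      case True
      then show ?thesis using int[of "sqrt (2 - s)"] by (simp add: ball_weight_def s_def)
    next
      case False
      \<comment> \<open>The section is empty or a single point; discs of arbitrarily small positive
        radius cover it.\<close>
      have "(\<integral>\<^sup>+z. indicator S (merge A B (y, z)) \<partial>(\<Pi>\<^sub>M i\<in>B. lborel)) \<le> 0"
      proof (rule ennreal_le_epsilon)
        fix e :: real assume e: "0 < e"
        have "(\<integral>\<^sup>+z. indicator S (merge A B (y, z)) \<partial>(\<Pi>\<^sub>M i\<in>B. lborel)) \<le> ennreal (pi * (sqrt (e / pi))^2)"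
          using False e by (intro int) (auto intro: order_trans[of _ 0])
        also have "pi * (sqrt (e / pi))^2 = e" using e by simp
        finally show "(\<integral>\<^sup>+z. indicator S (merge A B (y, z)) \<partial>(\<Pi>\<^sub>M i\<in>B. lborel)) \<le> 0 + ennreal e" by simp
      qed
      then show ?thesis by simp
    qed
  qed
  finally show ?thesis .
qed

lemma borel_measurable_box_ball_weight:
  fixes J :: "'n :: finite set"
  shows "(\<lambda>x :: real ^ 'n. ennreal (pi * ((if \<forall>i\<in>J. 0 \<le> x $ i \<and> x $ i < sqrt 2 then 1 else 0) * ball_weight (- J) (($) x)))) \<in> borel_measurable borel"
proof -
  define P where "P = (\<Inter>i. {x :: real ^ 'n. i \<in> J \<longrightarrow> 0 \<le> x $ i \<and> x $ i < sqrt 2})"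
  have "{x :: real ^ 'n. i \<in> J \<longrightarrow> 0 \<le> x $ i \<and> x $ i < sqrt 2} \<in> sets borel" for i
  proof (cases "i \<in> J")
    case True
    have "{x :: real ^ 'n. 0 \<le> x $ i} \<inter> {x. x $ i < sqrt 2} \<in> sets borel"
      by (intro sets.Int borel_closed borel_open closed_Collect_le open_Collect_less continuous_intros)
    then show ?thesis using True by (simp add: Collect_conj_eq)
  qed simp
  then have [measurable]: "P \<in> sets borel"
    unfolding P_def by (intro sets.countable_INT'') auto
  have [measurable]: "(\<lambda>x :: real ^ 'n. ball_weight (- J) (($) x)) \<in> borel_measurable borel"
    unfolding ball_weight_def by (intro borel_measurable_continuous_onI continuous_intros)
  have mem: "x \<in> P \<longleftrightarrow> (\<forall>i\<in>J. 0 \<le> x $ i \<and> x $ i < sqrt 2)" for x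
    unfolding P_def by blast
  show ?thesis
    unfolding mem[symmetric] by measurable
qed

text \<open>Tonelli: the box contributes sqrt 2 for each index in \<open>J\<close>, and the weight a
  ball of radius sqrt 2 in \<open>card (- J) + 2\<close> dimensions. The factor \<open>pi\<close> is
  the one in \<open>nn_integral_ball_weight\<close>.\<close>

lemma nn_integral_box_ball_weight:
  fixes J :: "'n :: finite set"
  shows "ennreal (sqrt 2 ^ (CARD('n) + 2) * unit_ball_vol (real (card (- J) + 2))) \<le>
    (\<integral>\<^sup>+x. ennreal (pi * ((if \<forall>i\<in>J. 0 \<le> x $ i \<and> x $ i < sqrt 2 then 1 else 0) * ball_weight (- J) (($) x))) \<partial>(lborel :: (real ^ 'n) measure))"
proof -
  interpret product_sigma_finite "\<lambda>_::real ^ 'n. lborel :: real measure" by standard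
  define ax where "ax i = (axis i 1 :: real ^ 'n)" for i
  have inj: "inj ax" by (auto simp: inj_def ax_def axis_eq_axis)
  have Basis_eq: "(Basis :: (real ^ 'n) set) = ax ` UNIV"
    by (auto simp: Basis_vec_def ax_def)
  define BJ BK where "BJ = ax ` J" and "BK = ax ` (- J)"
  have U: "(Basis :: (real ^ 'n) set) = BJ \<union> BK" "BJ \<inter> BK = {}"
    using inj by (auto simp: Basis_eq BJ_def BK_def inj_def)
  have fin: "finite BJ" "finite BK" by (auto simp: BJ_def BK_def)
  have card: "card BJ = card J" "card BK = card (- J)"
    using inj by (auto simp: BJ_def BK_def card_image inj_on_subset)
  define F :: "(real ^ 'n \<Rightarrow> real) \<Rightarrow> ennreal" where
    "F f = ennreal (pi * ((if \<forall>b\<in>BJ. 0 \<le> f b \<and> f b < sqrt 2 then 1 else 0) * ball_weight BK f))" for f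
  have comp: "(\<Sum>b\<in>Basis. f b *\<^sub>R b) $ i = f (ax i)" for f :: "real ^ 'n \<Rightarrow> real" and i
  proof -
    have "(\<Sum>b\<in>Basis. f b *\<^sub>R b) $ i = (\<Sum>j\<in>UNIV. (f (ax j) *\<^sub>R ax j) $ i)"
      unfolding Basis_eq sum_component by (simp add: sum.reindex[OF inj])
    also have "\<dots> = (\<Sum>j\<in>UNIV. if j = i then f (ax j) else 0)"
      by (intro sum.cong) (auto simp: ax_def axis_def)
    finally show ?thesis by simp
  qed
  have F_meas: "F \<in> borel_measurable (\<Pi>\<^sub>M b\<in>BJ \<union> BK. lborel)"
    unfolding F_def ball_weight_def using fin by measurable
  have bw: "ball_weight BK f = ball_weight (- J) (\<lambda>i. f (ax i))" for f
    unfolding ball_weight_def BK_def using inj by (subst sum.reindex) (auto intro: inj_on_subset)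
  have "(\<integral>\<^sup>+x. ennreal (pi * ((if \<forall>i\<in>J. 0 \<le> x $ i \<and> x $ i < sqrt 2 then 1 else 0) * ball_weight (- J) (($) x))) \<partial>(lborel :: (real ^ 'n) measure))
    = (\<integral>\<^sup>+f. F f \<partial>(\<Pi>\<^sub>M b\<in>BJ \<union> BK. lborel))"
  proof -
    define g where "g x = ennreal (pi * ((if \<forall>i\<in>J. 0 \<le> x $ i \<and> x $ i < sqrt 2 then 1 else 0) * ball_weight (- J) (($) x)))" for x :: "real ^ 'n"
    have lb: "(lborel :: (real ^ 'n) measure) = distr (Pi\<^sub>M (BJ \<union> BK) (\<lambda>_. lborel)) borel (\<lambda>f. \<Sum>b\<in>Basis. f b *\<^sub>R b)"
      unfolding U(1)[symmetric] by (rule lborel_eq)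
    have T: "(\<lambda>f. \<Sum>b\<in>Basis. f b *\<^sub>R b) \<in> measurable (Pi\<^sub>M (BJ \<union> BK) (\<lambda>_. lborel)) (borel :: (real ^ 'n) measure)"
      unfolding U(1)[symmetric] by measurable
    have g: "g \<in> borel_measurable borel"
      using borel_measurable_box_ball_weight[of J] unfolding g_def .
    have gF: "g (\<Sum>b\<in>Basis. f b *\<^sub>R b) = F f" for f
    proof -
      have "ball_weight (- J) (($) (\<Sum>b\<in>Basis. f b *\<^sub>R b)) = ball_weight BK f"
        unfolding bw by (simp only: ball_weight_def comp)
      then show ?thesis by (simp only: g_def F_def comp BJ_def ball_simps)
    qed
    have "(\<integral>\<^sup>+x. g x \<partial>lborel) = (\<integral>\<^sup>+f. g (\<Sum>b\<in>Basis. f b *\<^sub>R b) \<partial>(\<Pi>\<^sub>M b\<in>BJ \<union> BK. lborel))"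
      unfolding lb by (rule nn_integral_distr[OF T]) (use g in simp)
    then show ?thesis unfolding gF unfolding g_def .
  qed
  also have "\<dots> = (\<integral>\<^sup>+x. (\<integral>\<^sup>+y. F (merge BJ BK (x, y)) \<partial>(\<Pi>\<^sub>M b\<in>BK. lborel)) \<partial>(\<Pi>\<^sub>M b\<in>BJ. lborel))"
    by (rule product_nn_integral_fold[OF U(2) fin F_meas])
  also have "\<dots> = (\<integral>\<^sup>+x. indicator (\<Pi>\<^sub>E b\<in>BJ. {0..<sqrt 2}) x * (\<integral>\<^sup>+y. ennreal (pi * ball_weight BK y) \<partial>(\<Pi>\<^sub>M b\<in>BK. lborel)) \<partial>(\<Pi>\<^sub>M b\<in>BJ. lborel))"
  proof (rule nn_integral_cong)
    fix x assume x: "x \<in> space (\<Pi>\<^sub>M b\<in>BJ. lborel :: real measure)"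
    have "F (merge BJ BK (x, y)) = indicator (\<Pi>\<^sub>E b\<in>BJ. {0..<sqrt 2}) x * ennreal (pi * ball_weight BK y)" for y
    proof -
      have "ball_weight BK (merge BJ BK (x, y)) = ball_weight BK y"
        unfolding ball_weight_def using U(2) by (intro arg_cong[of _ _ "\<lambda>s. max 0 (2 - s)"] sum.cong) (auto simp: merge_def)
      moreover have "(\<forall>b\<in>BJ. 0 \<le> merge BJ BK (x, y) b \<and> merge BJ BK (x, y) b < sqrt 2) \<longleftrightarrow> x \<in> (\<Pi>\<^sub>E b\<in>BJ. {0..<sqrt 2})"
        using x by (auto simp: merge_def space_PiM PiE_def)
      ultimately show ?thesis unfolding F_def by (auto simp: indicator_def)
    qed
    then show "(\<integral>\<^sup>+y. F (merge BJ BK (x, y)) \<partial>(\<Pi>\<^sub>M b\<in>BK. lborel)) =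
        indicator (\<Pi>\<^sub>E b\<in>BJ. {0..<sqrt 2}) x * (\<integral>\<^sup>+y. ennreal (pi * ball_weight BK y) \<partial>(\<Pi>\<^sub>M b\<in>BK. lborel))"
      by (simp add: indicator_def)
  qed
  also have "\<dots> = emeasure (\<Pi>\<^sub>M b\<in>BJ. lborel) (\<Pi>\<^sub>E b\<in>BJ. {0..<sqrt 2}) * (\<integral>\<^sup>+y. ennreal (pi * ball_weight BK y) \<partial>(\<Pi>\<^sub>M b\<in>BK. lborel))"
    using fin by (subst nn_integral_multc) (auto intro!: sets_PiM_I_finite borel_measurable_indicator)
  also have "emeasure (\<Pi>\<^sub>M b\<in>BJ. lborel) (\<Pi>\<^sub>E b\<in>BJ. {0..<sqrt 2}) = (\<Prod>b\<in>BJ. emeasure lborel {0..<sqrt 2})"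
    using fin by (intro emeasure_PiM) auto
  also have "\<dots> = ennreal (sqrt 2 ^ card J)"
    by (simp add: card ennreal_power)
  finally have eq: "(\<integral>\<^sup>+x. ennreal (pi * ((if \<forall>i\<in>J. 0 \<le> x $ i \<and> x $ i < sqrt 2 then 1 else 0) * ball_weight (- J) (($) x))) \<partial>(lborel :: (real ^ 'n) measure))
    = ennreal (sqrt 2 ^ card J) * (\<integral>\<^sup>+y. ennreal (pi * ball_weight BK y) \<partial>(\<Pi>\<^sub>M b\<in>BK. lborel))" .
  \<comment> \<open>The two auxiliary coordinates need names outside \<open>BK\<close>; vectors of
    norm 2 and 0 are not basis vectors.\<close>
  have "norm b = 1" if "b \<in> BK" for b using U(1) norm_Basis that by blast
  moreover have "norm (2 *\<^sub>R ax i) = 2" for i by (simp add: ax_def)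
  ultimately have "2 *\<^sub>R ax i \<notin> BK" "0 \<notin> BK" "2 *\<^sub>R ax i \<noteq> 0" for i
    by (force, force, metis norm_zero zero_neq_numeral)
  then have le: "ennreal (unit_ball_vol (real (card BK + 2)) * sqrt 2 ^ (card BK + 2)) \<le>
    (\<integral>\<^sup>+y. ennreal (pi * ball_weight BK y) \<partial>(\<Pi>\<^sub>M b\<in>BK. lborel))"
    using fin(2) by (intro nn_integral_ball_weight[of BK "2 *\<^sub>R ax undefined" 0]) auto
  have "card J + card (- J) = CARD('n)"
    by (subst card_Un_disjoint[symmetric]) auto
  then have "sqrt 2 ^ (CARD('n) + 2) = sqrt 2 ^ card J * sqrt 2 ^ (card (- J) + 2)"
    by (simp flip: power_add)
  then have "ennreal (sqrt 2 ^ (CARD('n) + 2) * unit_ball_vol (real (card (- J) + 2)))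
    = ennreal (sqrt 2 ^ card J) * ennreal (unit_ball_vol (real (card BK + 2)) * sqrt 2 ^ (card BK + 2))"
    by (simp add: card ennreal_mult'[symmetric] mult_ac)
  also have "\<dots> \<le> ennreal (sqrt 2 ^ card J) * (\<integral>\<^sup>+y. ennreal (pi * ball_weight BK y) \<partial>(\<Pi>\<^sub>M b\<in>BK. lborel))"
    by (intro mult_left_mono le) simp
  finally show ?thesis unfolding eq .
qed

lemma orthonormal_family_extending:
  fixes S :: "(real ^ 'n) set"
  assumes S: "\<And>x. x \<in> S \<Longrightarrow> norm x = 1" "pairwise orthogonal S"
  shows "\<exists>u :: 'n \<Rightarrow> real ^ 'n. (\<forall>i j. u i \<bullet> u j = (if i = j then 1 else 0)) \<and> S \<subseteq> range u"
proof -
  have S0: "0 \<notin> S" using S(1) by force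
  have indS: "independent S" using pairwise_orthogonal_independent[OF S(2) S0] .
  define V where "V = {y \<in> UNIV. \<forall>x\<in>span S. orthogonal x y}"
  have V: "subspace V"
    unfolding V_def by (simp add: subspace_def orthogonal_def inner_add_right)
  obtain B where B: "B \<subseteq> V" "pairwise orthogonal B" "\<And>x. x \<in> B \<Longrightarrow> norm x = 1" "independent B" "card B = dim V"
    using orthonormal_basis_subspace[OF V] by metis
  have "dim V + dim (span S) = dim (UNIV :: (real ^ 'n) set)"
    unfolding V_def by (rule dim_subspace_orthogonal_to_vectors) auto
  then have "card B + card S = CARD('n)"
    using B(5) indS by (simp add: dim_eq_card_independent)
  moreover have "finite S" "finite B" using indS B(4) by (auto intro: independent_imp_finite)
  moreover have disj: "S \<inter> B = {}"
  proof -
    have "x \<notin> B" if "x \<in> S" for x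
    proof
      assume "x \<in> B"
      then have "orthogonal x x" using B(1) that span_base[of x S] by (auto simp: V_def)
      then show False using S0 that by (simp add: orthogonal_def)
    qed
    then show ?thesis by blast
  qed
  ultimately have "card (S \<union> B) = CARD('n)" "finite (S \<union> B)"
    by (auto simp: card_Un_disjoint)
  then obtain u where u: "bij_betw u (UNIV :: 'n set) (S \<union> B)"
    using finite_same_card_bij[of "UNIV :: 'n set" "S \<union> B"] by auto
  have orth: "x \<bullet> y = 0" if "x \<in> S \<union> B" "y \<in> S \<union> B" "x \<noteq> y" for x y
  proof -
    have SB: "orthogonal v w" if "v \<in> S" "w \<in> B" for v w
      using that B(1) span_base[of v S] by (auto simp: V_def)
    have "orthogonal x y"
      using that S(2) B(2) SB[of x y] SB[of y x] unfolding pairwise_def by (metis Un_iff orthogonal_commute)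
    then show ?thesis by (simp add: orthogonal_def)
  qed
  have "u i \<bullet> u j = (if i = j then 1 else 0)" for i j
  proof (cases "i = j")
    case True
    have "norm (u i) = 1" using S(1) B(3) bij_betwE[OF u] by blast
    then show ?thesis using True by (simp add: dot_square_norm)
  next
    case False
    then have "u i \<noteq> u j" using u by (auto simp: bij_betw_def inj_on_def)
    then show ?thesis using orth[of "u i" "u j"] bij_betwE[OF u] False by auto
  qed
  moreover have "S \<subseteq> range u" using u by (auto simp: bij_betw_def)
  ultimately show ?thesis by blast
qed

text \<open>Otherwise \<open>sin (31/60)\<close> would be at least
  \<open>sin (pi / 6) = 1/2\<close>, but its cubic Taylor polynomial is about 0.494 with error below
  0.001.\<close>

lemma pi_gt_31_div_10: "pi > 31 / 10"
proof (rule ccontr)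
  assume "\<not> pi > 31 / 10"
  then have "sin (pi / 6) \<le> sin (31 / 60)"
    using pi_ge_two by (intro sin_monotone_2pi_le) auto
  also have "sin (31 / 60) \<le> (4999 / 10000 :: real)"
  proof -
    have "(\<Sum>m<5. sin_coeff m * x ^ m) = x - x ^ 3 / 6" for x :: real
    proof -
      have "(\<Sum>m<5::nat. f m) = f 0 + f 1 + f 2 + f 3 + f 4" for f :: "nat \<Rightarrow> real"
        by (simp add: eval_nat_numeral)
      then show ?thesis by (simp add: sin_coeff_def fact_numeral)
    qed
    then have "\<bar>sin (31 / 60) - (31 / 60 - (31 / 60) ^ 3 / 6)\<bar> \<le> inverse (fact 5) * \<bar>31 / 60 :: real\<bar> ^ 5"
      using Maclaurin_sin_bound[of "31 / 60" 5] by simp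
    from abs_le_D1[OF this] show ?thesis by (simp add: fact_numeral power_numeral_reduce)
  qed
  finally show False by (simp add: sin_30)
qed

text \<open>The bound is sharp up to 5 percent for \<open>j = 5\<close>, which is why \<open>\<pi> > 3\<close> does not suffice.\<close>

lemma unit_ball_vol_bounds:
  assumes "j < 12"
  shows "real (min (2 * 2 ^ j) 64) * pi < 64 * unit_ball_vol (real (14 - j))"
proof -
  \<comment> \<open>In the applications \<open>c\<close> is the rational coefficient of
    \<open>64 * unit_ball_vol (14 - j)\<close> and \<open>k\<close> is one less than its exponent of
    \<open>pi\<close>, one factor \<open>pi\<close> cancelling.\<close>
  have key: "n * pi < 64 * v" if "n < c * (31 / 10) ^ k" "64 * v = c * pi ^ k * pi" "c > 0" for n v c :: real and k
  proof -
    have "(31 / 10) ^ k \<le> pi ^ k" using pi_gt_31_div_10 by (intro power_mono) auto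
    then have "n < c * pi ^ k" using that(1,3) by (meson less_le_trans mult_left_mono less_imp_le)
    then show ?thesis unfolding that(2) by simp
  qed
  consider "j = 0" | "j = 1" | "j = 2" | "j = 3" | "j = 4" | "j = 5" | "j = 6" | "j = 7" | "j = 8" | "j = 9" | "j = 10" | "j = 11"
  proof -
    have "j = 0 \<or> j = 1 \<or> j = 2 \<or> j = 3 \<or> j = 4 \<or> j = 5 \<or>
        j = 6 \<or> j = 7 \<or> j = 8 \<or> j = 9 \<or> j = 10 \<or> j = 11"
      using assms by presburger
    then show ?thesis using that by blast
  qed
  then show ?thesis
  proof cases
    case 1
    then show ?thesis by (intro key[of _ "64/5040" 6]) (simp_all add: eval_unit_ball_vol power_numeral_reduce)
  next
    case 2
    then show ?thesis by (intro key[of _ "8192/135135" 5]) (simp_all add: eval_unit_ball_vol power_numeral_reduce)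
  next
    case 3
    then show ?thesis by (intro key[of _ "64/720" 5]) (simp_all add: eval_unit_ball_vol power_numeral_reduce)
  next
    case 4
    then show ?thesis by (intro key[of _ "4096/10395" 4]) (simp_all add: eval_unit_ball_vol power_numeral_reduce)
  next
    case 5
    then show ?thesis by (intro key[of _ "64/120" 4]) (simp_all add: eval_unit_ball_vol power_numeral_reduce)
  next
    case 6
    then show ?thesis by (intro key[of _ "2048/945" 3]) (simp_all add: eval_unit_ball_vol power_numeral_reduce)
  next
    case 7
    then show ?thesis by (intro key[of _ "64/24" 3]) (simp_all add: eval_unit_ball_vol power_numeral_reduce)
  next
    case 8
    then show ?thesis by (intro key[of _ "1024/105" 2]) (simp_all add: eval_unit_ball_vol power_numeral_reduce)
  next
    case 9
    then show ?thesis by (intro key[of _ "64/6" 2]) (simp_all add: eval_unit_ball_vol power_numeral_reduce)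
  next
    case 10
    then show ?thesis by (intro key[of _ "512/15" 1]) (simp_all add: eval_unit_ball_vol power_numeral_reduce)
  next
    case 11
    then show ?thesis by (intro key[of _ "32" 1]) (simp_all add: eval_unit_ball_vol power_numeral_reduce)
  next
    case 12
    then show ?thesis by (intro key[of _ "256/3" 0]) (simp_all add: eval_unit_ball_vol power_numeral_reduce)
  qed
qed

lemma exists_orthogonal_root:
  fixes L :: "(real ^ 12) set"
  assumes L: "L = dual_lattice L" and lat: "is_lattice L"
    and R: "finite R" "R \<subseteq> L" and rr: "\<And>r. r \<in> R \<Longrightarrow> r \<bullet> r = 2"
    and orth: "\<And>r s. r \<in> R \<Longrightarrow> s \<in> R \<Longrightarrow> r \<noteq> s \<Longrightarrow> r \<bullet> s = 0"
    and card: "card R < 12"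
  shows "\<exists>x\<in>L. x \<bullet> x = 2 \<and> (\<forall>r\<in>R. x \<bullet> r = 0)"
proof (rule ccontr)
  assume noroot: "\<not> ?thesis"
  define S where "S = (\<lambda>r. (1 / sqrt 2) *\<^sub>R r) ` R"
  have "norm x = 1" if "x \<in> S" for x
    using that rr by (auto simp: S_def norm_eq_sqrt_inner)
  moreover have "pairwise orthogonal S"
    unfolding pairwise_def S_def orthogonal_def using orth by auto
  ultimately obtain u :: "12 \<Rightarrow> real ^ 12" where u: "\<And>i j. u i \<bullet> u j = (if i = j then 1 else 0)" and Su: "S \<subseteq> range u"
    using orthonormal_family_extending[of S] by blast
  have u_inj: "inj u"
    using u by (metis injI zero_neq_one)
  define J where "J = {i. u i \<in> S}"
  have uJ: "u ` J = S" using Su by (auto simp: J_def)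
  have "card J = card S" using card_image[of u J] u_inj uJ by (metis inj_on_subset subset_UNIV)
  also have "\<dots> = card R" unfolding S_def by (rule card_image) (simp add: inj_on_def)
  finally have cJ: "card J = card R" .
  have Jr: "sqrt 2 *\<^sub>R u i \<in> R" if "i \<in> J" for i
    using that by (auto simp: J_def S_def)
  have rJ: "\<exists>i\<in>J. r = sqrt 2 *\<^sub>R u i" if "r \<in> R" for r
  proof -
    have "(1 / sqrt 2) *\<^sub>R r \<in> u ` J" unfolding uJ S_def using that by blast
    then obtain i where i: "i \<in> J" "(1 / sqrt 2) *\<^sub>R r = u i" by auto
    have "sqrt 2 *\<^sub>R u i = r" unfolding i(2)[symmetric] by simp
    then show ?thesis using i(1) by auto
  qed
  obtain b :: "12 \<Rightarrow> real ^ 12" where Lb: "L = {\<Sum>i\<in>UNIV. of_int (c i) *\<^sub>R b i | c :: 12 \<Rightarrow> int. True}"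
    and detb: "\<bar>det (\<chi> i. b i)\<bar> = 1"
    using unimodular_lattice_basis[OF L lat] by blast
  \<comment> \<open>\<open>\<phi> z\<close> lists the coordinates of the lattice vector
    \<open>l z\<close> in the basis \<open>u\<close>, whose members indexed by \<open>J\<close> are
    the normalised roots of \<open>R\<close>.\<close>
  define \<phi> :: "real ^ 12 \<Rightarrow> real ^ 12" where "\<phi> t = (\<chi> k. \<Sum>i\<in>UNIV. t $ i * (b i \<bullet> u k))" for t
  define l where "l z = (\<Sum>i\<in>UNIV. z $ i *\<^sub>R b i)" for z :: "real ^ 12"
  have \<phi>l: "\<phi> z $ k = l z \<bullet> u k" for z k by (simp add: \<phi>_def l_def inner_sum_left)
  have lin: "linear \<phi>"
    by (rule linearI) (simp_all add: \<phi>_def vec_eq_iff sum.distrib distrib_right sum_distrib_left mult.assoc)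
  have det: "\<bar>det (matrix \<phi>)\<bar> = 1"
  proof -
    define V :: "real ^ 12 ^ 12" where "V = (\<chi> k. u k)"
    have "matrix \<phi> = V ** transpose (\<chi> i. b i)"
      by (simp add: vec_eq_iff matrix_def \<phi>_def axis_def V_def transpose_def matrix_matrix_mult_def
          if_distrib[of "\<lambda>x. x * _"] inner_vec_def mult.commute cong: if_cong)
    moreover have "V ** transpose V = mat 1"
      using u by (simp add: matrix_matrix_mult_def mat_def transpose_def V_def vec_eq_iff inner_vec_def)
    then have "det V * det V = 1"
      by (metis det_I det_mul det_transpose)
    then have "\<bar>det V\<bar> = 1" by (metis abs_1 abs_mult_self_eq real_sqrt_abs2 real_sqrt_one)
    ultimately show ?thesis using detb by (simp add: det_mul abs_mult)
  qed
  have l_inj: "l z = l z' \<Longrightarrow> z = z'" for z z'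
  proof -
    assume "l z = l z'"
    then have "\<phi> z $ k = \<phi> z' $ k" for k unfolding \<phi>l by (rule arg_cong)
    then have "\<phi> z = \<phi> z'" by (rule vec_eq_iff[THEN iffD2, OF allI])
    moreover have "inj ((*v) (matrix \<phi>))"
      using det invertible_det_nz[of "matrix \<phi>"] by (intro inj_matrix_vector_mult) auto
    moreover have "\<phi> t = matrix \<phi> *v t" for t using lin by (simp add: matrix_works)
    ultimately show "z = z'" by (metis injD)
  qed
  have lL: "l z \<in> L" if "\<forall>i. z $ i \<in> \<int>" for z
  proof -
    have "z $ i = of_int \<lfloor>z $ i\<rfloor>" for i using that by (auto elim!: Ints_cases dest!: spec[of _ i])
    then have "l z = (\<Sum>i\<in>UNIV. of_int \<lfloor>z $ i\<rfloor> *\<^sub>R b i)" unfolding l_def by (intro sum.cong) auto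
    then show ?thesis unfolding Lb by (intro CollectI exI[of _ "\<lambda>i. \<lfloor>z $ i\<rfloor>"]) simp
  qed
  define N where "N = card (parity_signature R ` L)"
  have finS: "finite (parity_signature R ` L)" using card_parity_signatures_le_power[OF R(1)] by blast
  define G where "G x = (if \<forall>i\<in>J. 0 \<le> x $ i \<and> x $ i < sqrt 2 then 1 else 0) * ball_weight (- J) (($) x)" for x :: "real ^ 12"
  have Gsum: "(\<Sum>z\<in>F. G (x + \<phi> z)) \<le> 2 * real N"
    if F: "finite F" "F \<subseteq> {z. \<forall>i. z $ i \<in> \<int>}" for x F
  proof -
    define F' where "F' = {z\<in>F. G (x + \<phi> z) \<noteq> 0}"
    define q where "q z i = (x + \<phi> z) $ i" for z i
    have F': "finite F'" "F' \<subseteq> {z. \<forall>i. z $ i \<in> \<int>}" using F by (auto simp: F'_def)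
    have box: "0 \<le> q z i" "q z i < sqrt 2" if "z \<in> F'" "i \<in> J" for z i
      using that by (auto simp: F'_def G_def q_def split: if_splits)
    have Gq: "G (x + \<phi> z) = 2 - (\<Sum>i\<in>- J. (q z i)^2)" if "z \<in> F'" for z
      using that by (auto simp: F'_def G_def q_def ball_weight_def max_def split: if_splits)
    have class_le: "(\<Sum>z\<in>{z\<in>F'. parity_signature R (l z) = \<sigma>}. G (x + \<phi> z)) \<le> 2" for \<sigma>
    proof -
      define P where "P = {z\<in>F'. parity_signature R (l z) = \<sigma>}"
      have "(\<Sum>z\<in>P. G (x + \<phi> z)) = (\<Sum>z\<in>P. 2 - (\<Sum>i\<in>- J. (q z i)^2))"
        by (intro sum.cong) (auto simp: P_def Gq)
      also have "\<dots> \<le> 2"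
      proof (rule sum_ball_weights_le)
        show "finite P" using F' by (simp add: P_def)
        show "finite (- J)" by simp
        fix z z' assume z: "z \<in> P" "z' \<in> P" "z \<noteq> z'"
        define d where "d = l z - l z'"
        have d0: "d \<noteq> 0" using l_inj z(3) by (auto simp: d_def)
        have lz: "l z \<in> L" "l z' \<in> L" using z F' lL by (auto simp: P_def)
        have dL: "d \<in> L" unfolding d_def by (rule self_dual_diff[OF L lz])
        have sig: "parity_signature R (l z) = parity_signature R (l z')" using z by (simp add: P_def)
        have dq: "d \<bullet> u i = q z i - q z' i" for i by (simp add: d_def q_def \<phi>l inner_diff_left)
        \<comment> \<open>Against a root, \<open>d\<close> has an even inner product of absolute
          value below 2, hence 0. The half-open box makes this strict.\<close>
        have dJ: "d \<bullet> u i = 0" if i: "i \<in> J" for i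
        proof -
          have "d \<bullet> (sqrt 2 *\<^sub>R u i) / 2 \<in> \<int>"
            unfolding d_def by (rule parity_signature_diff(2)[OF L R(2) lz sig Jr[OF i]])
          then obtain k where k: "d \<bullet> (sqrt 2 *\<^sub>R u i) / 2 = of_int k" by (rule Ints_cases)
          have "\<bar>d \<bullet> u i\<bar> < sqrt 2"
            using box[of z i] box[of z' i] z i by (auto simp: dq P_def)
          then have "sqrt 2 * \<bar>d \<bullet> u i\<bar> < sqrt 2 * sqrt 2" by (intro mult_strict_left_mono) auto
          then have "\<bar>d \<bullet> (sqrt 2 *\<^sub>R u i) / 2\<bar> < 1" by (simp add: abs_mult)
          then have "k = 0" unfolding k by linarith
          then show ?thesis using k by simp
        qed
        have dd: "d \<bullet> d = (\<Sum>i\<in>- J. (q z i - q z' i)^2)"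
        proof -
          have "d \<bullet> d = (\<Sum>i\<in>UNIV. (d \<bullet> u i)^2)"
            using orthonormal_family_inner[OF u, of d d] by (simp add: power2_eq_square)
          also have "\<dots> = (\<Sum>i\<in>- J. (d \<bullet> u i)^2)"
            using dJ by (intro sum.mono_neutral_right) auto
          finally show ?thesis by (simp add: dq)
        qed
        have "d \<bullet> d / 2 \<in> \<int>"
          unfolding d_def by (rule parity_signature_diff(1)[OF L R(2) lz sig])
        then obtain k where k: "d \<bullet> d / 2 = of_int k" by (rule Ints_cases)
        \<comment> \<open>\<open>d\<close> is nonzero, of even norm and orthogonal to
          \<open>R\<close>, so norm 2 would make it the missing root.\<close>
        have "d \<bullet> d > 0" using d0 by simp
        then have "k > 0" using k by (metis divide_pos_pos of_int_0_less_iff zero_less_numeral)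
        moreover have "k \<noteq> 1"
        proof
          assume "k = 1"
          then have "d \<bullet> d = 2" using k by simp
          moreover have "\<forall>r\<in>R. d \<bullet> r = 0" using rJ dJ by (metis inner_scaleR_right mult_zero_right)
          ultimately show False using noroot dL by blast
        qed
        ultimately have "real_of_int k \<ge> 2" by linarith
        then show "4 \<le> (\<Sum>i\<in>- J. (q z i - q z' i)^2)" using k unfolding dd by linarith
      qed
      finally show ?thesis unfolding P_def .
    qed
    have "(\<Sum>z\<in>F. G (x + \<phi> z)) = (\<Sum>z\<in>F'. G (x + \<phi> z))"
      using F by (intro sum.mono_neutral_right) (auto simp: F'_def)
    also have "\<dots> = (\<Sum>\<sigma>\<in>(\<lambda>z. parity_signature R (l z)) ` F'. \<Sum>z\<in>{z\<in>F'. parity_signature R (l z) = \<sigma>}. G (x + \<phi> z))"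
      by (rule sum.image_gen[OF F'(1)])
    also have "\<dots> \<le> (\<Sum>\<sigma>\<in>(\<lambda>z. parity_signature R (l z)) ` F'. 2)"
      by (rule sum_mono) (rule class_le)
    also have "\<dots> = 2 * real (card ((\<lambda>z. parity_signature R (l z)) ` F'))" by simp
    also have "\<dots> \<le> 2 * real N"
      unfolding N_def using F' lL by (intro mult_left_mono of_nat_mono card_mono finS) auto
    finally show ?thesis .
  qed
  have Gnn: "G x \<ge> 0" for x by (simp add: G_def ball_weight_def)
  have "(\<integral>\<^sup>+x. ennreal (pi * G x) \<partial>lborel) \<le> ennreal (pi * (2 * real N)) * ennreal \<bar>det (matrix \<phi>)\<bar>"
  proof (rule lattice_nn_integral_le[OF lin])
    show "det (matrix \<phi>) \<noteq> 0" using det by auto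
    show "(\<lambda>x. ennreal (pi * G x)) \<in> borel_measurable borel"
      unfolding G_def by (rule borel_measurable_box_ball_weight)
    fix x and F :: "(real ^ 12) set" assume F: "finite F" "F \<subseteq> {z. \<forall>i. z $ i \<in> \<int>}"
    have "(\<Sum>z\<in>F. ennreal (pi * G (x + \<phi> z))) = ennreal (pi * (\<Sum>z\<in>F. G (x + \<phi> z)))"
      using Gnn by (simp add: sum_ennreal sum_distrib_left)
    also have "\<dots> \<le> ennreal (pi * (2 * real N))"
      using Gsum[OF F] by (intro ennreal_leI mult_left_mono) auto
    finally show "(\<Sum>z\<in>F. ennreal (pi * G (x + \<phi> z))) \<le> ennreal (pi * (2 * real N))" .
  qed
  moreover have "ennreal (sqrt 2 ^ (CARD(12) + 2) * unit_ball_vol (real (card (- J) + 2))) \<le> (\<integral>\<^sup>+x. ennreal (pi * G x) \<partial>lborel)"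
    unfolding G_def by (rule nn_integral_box_ball_weight)
  ultimately have "ennreal (sqrt 2 ^ (CARD(12) + 2) * unit_ball_vol (real (card (- J) + 2))) \<le> ennreal (pi * (2 * real N))"
    using det by (simp add: order_trans)
  then have "sqrt 2 ^ (CARD(12) + 2) * unit_ball_vol (real (card (- J) + 2)) \<le> pi * (2 * real N)"
    by (subst (asm) ennreal_le_iff) auto
  moreover have s128: "sqrt 2 ^ (CARD(12) + 2) = (128 :: real)"
    using power_mult[of "sqrt 2" 2 7] by simp
  moreover have cJ': "card (- J) + 2 = 14 - card R"
    using card by (simp add: Compl_eq_Diff_UNIV card_Diff_subset cJ)
  ultimately have "128 * unit_ball_vol (real (14 - card R)) \<le> pi * (2 * real N)"
    by (simp only: s128 cJ')
  then have "64 * unit_ball_vol (real (14 - card R)) \<le> real N * pi" by (simp add: mult.commute)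
  also have "\<dots> \<le> real (min (2 * 2 ^ card R) 64) * pi"
    using card_parity_signatures_le_power(2)[OF R(1), of L] card_parity_signatures_le_64[OF L lat R rr orth]
    by (intro mult_right_mono of_nat_mono) (auto simp: N_def)
  also have "\<dots> < 64 * unit_ball_vol (real (14 - card R))" by (rule unit_ball_vol_bounds[OF card])
  finally show False by simp
qed

lemma contains_frame_2:
  fixes L :: "(real ^ 12) set"
  assumes L: "L = dual_lattice L" and lat: "is_lattice L"
  shows "contains_frame 2 L"
proof -
  have "j \<le> 12 \<Longrightarrow> \<exists>R. finite R \<and> card R = j \<and> R \<subseteq> L \<and> (\<forall>r\<in>R. r \<bullet> r = 2) \<and> (\<forall>r\<in>R. \<forall>s\<in>R. r \<noteq> s \<longrightarrow> r \<bullet> s = 0)" for j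
  proof (induction j)
    case 0
    show ?case by (intro exI[of _ "{}"]) simp
  next
    case (Suc j)
    then obtain R where R: "finite R" "card R = j" "R \<subseteq> L" "\<forall>r\<in>R. r \<bullet> r = 2" "\<forall>r\<in>R. \<forall>s\<in>R. r \<noteq> s \<longrightarrow> r \<bullet> s = 0"
      by auto
    have "card R < 12" using R(2) Suc.prems by simp
    then obtain x where x: "x \<in> L" "x \<bullet> x = 2" "\<forall>r\<in>R. x \<bullet> r = 0"
      using exists_orthogonal_root[OF L lat R(1,3)] R(4,5) by blast
    then have "x \<notin> R" by auto
    then show ?case
      using R x by (intro exI[of _ "insert x R"]) (auto simp: inner_commute)
  qed
  from this[of 12] obtain R where R: "finite R" "card R = 12" "R \<subseteq> L" "\<forall>r\<in>R. r \<bullet> r = 2" "\<forall>r\<in>R. \<forall>s\<in>R. r \<noteq> s \<longrightarrow> r \<bullet> s = 0"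
    by auto
  then obtain f where f: "bij_betw f (UNIV :: 12 set) R"
    using finite_same_card_bij[of "UNIV :: 12 set" R] by auto
  have fR: "f i \<in> R" for i using bij_betwE[OF f] by blast
  have "f i \<bullet> f j = (if i = j then real 2 else 0)" for i j
  proof (cases "i = j")
    case False
    then have "f i \<noteq> f j" using f by (auto simp: bij_betw_def inj_on_def)
    then show ?thesis using False R(5) fR by simp
  qed (use R(4) fR in simp)
  then show ?thesis
    unfolding contains_frame_def is_frame_def using fR R(3) by (intro exI[of _ f]) auto
qed

theorem theorem4p1:
  fixes L :: "(real ^ 12) set" and k :: nat
  assumes "unimodular_lattice L"
    and "odd_lattice L"
    and "has_minimum_norm L 2"
    and "k > 0"
  shows "contains_frame k L \<longleftrightarrow> k \<ge> 2"
proof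
  have L: "L = dual_lattice L" and lat: "is_lattice L"
    using assms(1) unfolding unimodular_lattice_def by blast+
  have min: "2 \<le> x \<bullet> x" if "x \<in> L" "x \<noteq> 0" for x
    using assms(3) that unfolding has_minimum_norm_def by blast
  {
    assume "contains_frame k L"
    then obtain f :: "12 \<Rightarrow> real ^ 12" where "\<forall>i. f i \<in> L" "\<forall>i j. f i \<bullet> f j = (if i = j then real k else 0)"
      unfolding contains_frame_def is_frame_def by blast
    then have f: "f 0 \<in> L" "f 0 \<bullet> f 0 = real k" by simp_all
    then have "f 0 \<noteq> 0" using assms(4) by auto
    then show "k \<ge> 2" using min[OF f(1)] f(2) by simp
  next
    assume k: "k \<ge> 2"
    have frame: "contains_frame 2 L" by (rule contains_frame_2[OF L lat])
    obtain u :: "12 \<Rightarrow> real ^ 12" where u: "\<forall>i j. u i \<bullet> u j = (if i = j then 1 else 0)"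
      and spin: "\<forall>y :: 12 \<Rightarrow> int. (\<forall>i. odd (y i)) \<longrightarrow> 4 dvd (\<Sum>i\<in>UNIV. y i) \<longrightarrow>
        (1/2) *\<^sub>R (\<Sum>i\<in>UNIV. of_int (y i) *\<^sub>R u i) \<in> L"
      using frame_to_D12_plus[OF L min assms(2) frame] by blast
    show "contains_frame k L"
      by (rule contains_frame_ge_2[OF L frame u[rule_format] spin[rule_format] k])
  }
qed

end
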